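(* There is a monoid isomorphism $$B^2(G,S^* )/B^2(G,U(S))\simeq Sl(G).$$
   Context: Standing assumptions: $R$ is a complete discrete valuation ring with quotient field $K$, $L$ is a finite Galois extension of $K$ with Galois group $G$, unramified with finite residue field; $S$ is the integral closure of $R$ in $L$, $\pi S$ its unique maximal ideal, $S^*=S\setminus\{0\}$, and $U(S)$ the group of units of $S$. For $\sigma\in G$ and a function $a$ with values in $L$, $a^\sigma(\tau)$ means $\sigma(a(\tau))$. $B^2(G,S^* )$ is the set of all functions $b:G\times G\to S^*$ for which there exists a function $a:G\to S^*$ with $a(1)=1$ such that $b(\sigma,\tau)=a(\sigma)a^{\sigma}(\tau)a(\sigma\tau)^{-1}$ for all $\sigma,\tau\in G$ (the inverse being taken in $L$). It is a monoid under pointwise multiplication. $B^2(G,U(S))$ is the group, under pointwise multiplication, of all functions $b:G\times G\to U(S)$ of the form $b(\sigma,\tau)=a(\sigma)a^{\sigma}(\tau)a(\sigma\tau)^{-1}$ for a function $a:G\to U(S)$; all cocycles are taken normalized ($b(1,\sigma)=b(\sigma,1)=1$, $a(1)=1$). On $B^2(G,S^* )$ consider the equivalence relation $b_1\sim b_2\Leftrightarrow b_1B^2(G,U(S))=b_2B^2(G,U(S))$; $B^2(G,S^* )/B^2(G,U(S))$ denotes the set of classes $\overline{b}$, a monoid under $\overline{b_1}\cdot\overline{b_2}=\overline{b_1b_2}$. $Sl(G)$ is the set of all functions $r:G\to\mathbb{N}$ (with $0\in\mathbb{N}$) satisfying $r(1)=0$ and $r(\sigma\tau)\leq r(\sigma)+r(\tau)$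 for all $\sigma,\tau\in G$; it is a monoid under pointwise addition. *)

theory Defs
  imports "HOL-Algebra.Algebra"
begin

definition discrete_valuation_ring :: "('a, 'b) ring_scheme \<Rightarrow> bool" where
  "discrete_valuation_ring A \<longleftrightarrow>
     principal_domain A \<and> \<not> field A \<and> (\<exists>!P. maximalideal P A)"

definition adic_complete :: "('a, 'b) ring_scheme \<Rightarrow> 'a set \<Rightarrow> bool" where
  "adic_complete A I \<longleftrightarrow>
     (\<forall>x :: nat \<Rightarrow> 'a.
        (\<forall>n. x n \<in> carrier A) \<longrightarrow>
        (\<forall>k :: nat. \<exists>N. \<forall>m \<ge> N. \<forall>n \<ge> N. x m \<ominus>\<^bsub>A\<^esub> x n \<in> I [^]\<^bsub>ideals_set A\<^esub> k) \<longrightarrow>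
        (\<exists>y \<in> carrier A.
           \<forall>k :: nat. \<exists>N. \<forall>n \<ge> N. x n \<ominus>\<^bsub>A\<^esub> y \<in> I [^]\<^bsub>ideals_set A\<^esub> k))"

definition quotient_field_in :: "('a, 'b) ring_scheme \<Rightarrow> 'a set \<Rightarrow> 'a set" where
  "quotient_field_in L R =
     {a \<otimes>\<^bsub>L\<^esub> inv\<^bsub>L\<^esub> b | a b. a \<in> R \<and> b \<in> R \<and> b \<noteq> \<zero>\<^bsub>L\<^esub>}"

text \<open>Polynomials are coefficient lists with the leading coefficient first, so
  \<open>hd p = \<one>\<close> says that \<open>p\<close> is monic.\<close>

definition integral_closure :: "('a, 'b) ring_scheme \<Rightarrow> 'a set \<Rightarrow> 'a set" where
  "integral_closure L R =
     {x \<in> carrier L. \<exists>p. p \<noteq> [] \<and> set p \<subseteq> R \<and> hd p = \<one>\<^bsub>L\<^esub> \<and> ring.eval L p x = \<zero>\<^bsub>L\<^esub>}"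

text \<open>As for \<open>AutoGroup\<close> in the library, automorphisms are extensional functions on the
  carrier, and the product of \<open>\<sigma>\<close> and \<open>\<tau>\<close> is \<open>\<sigma> \<circ> \<tau>\<close>.\<close>

definition Gal :: "('a, 'b) ring_scheme \<Rightarrow> 'a set \<Rightarrow> ('a \<Rightarrow> 'a) monoid" where
  "Gal L K = BijGroup (carrier L)
     \<lparr>carrier := {\<sigma> \<in> Bij (carrier L). \<sigma> \<in> ring_hom L L \<and> (\<forall>x \<in> K. \<sigma> x = x)}\<rparr>"

definition finite_galois_extension :: "('a, 'b) ring_scheme \<Rightarrow> 'a set \<Rightarrow> bool" where
  "finite_galois_extension L K \<longleftrightarrow>
     field L \<and> subfield K L \<and> ring.finite_dimension L K (carrier L) \<and>
     {x \<in> carrier L. \<forall>\<sigma> \<in> carrier (Gal L K). \<sigma> x = x} = K"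

text \<open>Here \<open>M\<close> is the maximal ideal of the base ring and \<open>B\<close> is its integral closure in the
  extension field. The condition is that \<open>M\<close> generates the maximal ideal of \<open>B\<close>, i.e. that the
  ramification index is 1. The residue field extension is also required to be separable for an
  unramified extension; this is automatic when the residue field is finite, which is the only
  case in which the definition is used.\<close>

definition unramified :: "'a set \<Rightarrow> ('a, 'b) ring_scheme \<Rightarrow> bool" where
  "unramified M B \<longleftrightarrow> maximalideal (Idl\<^bsub>B\<^esub> M) B"

text \<open>Functions on \<open>G\<close> or \<open>G \<times> G\<close> are extensional. The set \<open>M\<close> of admissible values is
  \<open>S - {\<zero>}\<close> or the group of units of \<open>S\<close>; inverses are taken in \<open>L\<close>.\<close>

definition B2 :: "('a, 'b) ring_scheme \<Rightarrow> ('a \<Rightarrow> 'a) monoid \<Rightarrow> 'a set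
    \<Rightarrow> ((('a \<Rightarrow> 'a) \<times> ('a \<Rightarrow> 'a)) \<Rightarrow> 'a) monoid" where
  "B2 L G M =
     \<lparr>carrier = {b \<in> carrier G \<times> carrier G \<rightarrow>\<^sub>E M.
        \<exists>a \<in> carrier G \<rightarrow>\<^sub>E M. a \<one>\<^bsub>G\<^esub> = \<one>\<^bsub>L\<^esub> \<and>
          (\<forall>\<sigma> \<in> carrier G. \<forall>\<tau> \<in> carrier G.
             b (\<sigma>, \<tau>) = a \<sigma> \<otimes>\<^bsub>L\<^esub> \<sigma> (a \<tau>) \<otimes>\<^bsub>L\<^esub> inv\<^bsub>L\<^esub> (a (\<sigma> \<otimes>\<^bsub>G\<^esub> \<tau>)))},
      monoid.mult = (\<lambda>b c. \<lambda>p \<in> carrier G \<times> carrier G. b p \<otimes>\<^bsub>L\<^esub> c p),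
      monoid.one = (\<lambda>p \<in> carrier G \<times> carrier G. \<one>\<^bsub>L\<^esub>)\<rparr>"

definition coset_rel :: "('c, 'd) monoid_scheme \<Rightarrow> 'c set \<Rightarrow> ('c \<times> 'c) set" where
  "coset_rel M H =
     {(x, y). x \<in> carrier M \<and> y \<in> carrier M \<and> x <#\<^bsub>M\<^esub> H = y <#\<^bsub>M\<^esub> H}"

text \<open>When the multiplication of classes is well defined, the union below is over copies of one
  and the same class.\<close>

definition quotient_monoid :: "('c, 'd) monoid_scheme \<Rightarrow> 'c set \<Rightarrow> 'c set monoid" where
  "quotient_monoid M H =
     \<lparr>carrier = carrier M // coset_rel M H,
      monoid.mult = (\<lambda>C D. \<Union>x \<in> C. \<Union>y \<in> D. coset_rel M H `` {x \<otimes>\<^bsub>M\<^esub> y}),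
      monoid.one = coset_rel M H `` {\<one>\<^bsub>M\<^esub>}\<rparr>"

definition Sl :: "('g, 'h) monoid_scheme \<Rightarrow> ('g \<Rightarrow> nat) monoid" where
  "Sl G =
     \<lparr>carrier = {r \<in> carrier G \<rightarrow>\<^sub>E (UNIV :: nat set). r \<one>\<^bsub>G\<^esub> = 0 \<and>
        (\<forall>\<sigma> \<in> carrier G. \<forall>\<tau> \<in> carrier G. r (\<sigma> \<otimes>\<^bsub>G\<^esub> \<tau>) \<le> r \<sigma> + r \<tau>)},
      monoid.mult = (\<lambda>r s. \<lambda>\<sigma> \<in> carrier G. r \<sigma> + s \<sigma>),
      monoid.one = (\<lambda>\<sigma> \<in> carrier G. 0)\<rparr>"

end

theory Submission
  imports Defs
begin

text \<open>A uniformizer \<open>\<pi>\<close> of \<open>R\<close> is also one of \<open>S\<close>, because the extension is unramified; hence it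
  gives a valuation \<open>v\<close> on \<open>S - {0}\<close> that is invariant under \<open>G\<close>. The isomorphism sends the class
  of the coboundary of \<open>a\<close> to \<open>v \<circ> a\<close>. Subadditivity of \<open>v \<circ> a\<close> says exactly that the coboundary
  has values in \<open>S\<close>, and \<open>r\<close> is attained at \<open>a \<sigma> = \<pi> ^ r \<sigma>\<close>. If two cochains have the same
  coboundary, or coboundaries that differ by one of units, the difference of their valuations is a
  homomorphism from the finite group \<open>G\<close> to the integers and vanishes; conversely, cochains with
  equal valuations differ by a cochain of units.\<close>

section \<open>Uniformizers and finiteness of the Galois group\<close>

text \<open>The ramification hypothesis says that \<pi> S is a maximal ideal, not that it is the
  only one, so factorizations x = u \<pi>^n in S do not come for free. Two facts about integral
  elements supply them. For z in S the element 1 - \<pi> z divides some 1 + \<pi> d with d in R,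
  which is a unit; hence \<pi> lies in the Jacobson radical and S is local. And every nonzero x in S
  divides a nonzero element of R, the last nonzero coefficient of a monic equation for x, so \<pi>
  can be split off only finitely often. The valuation is invariant because \<pi> lies in R, hence in
  K, and is fixed by G.

  On the side of cocycles the obstacle is that coboundaries with values in S - {0} need not be
  invertible among themselves, so equality of cosets cannot be tested on a quotient of cocycles. The
  quotient is formed on cochains instead, inside L, and the classes are treated as the fibres of the
  map to Sl(G). A cocycle does not determine its cochain; that the map is nevertheless well defined
  is where the finiteness of G enters.\<close>

lemma (in principal_domain) local_uniformizer:
  assumes "\<not> field R" and "\<exists>!P. maximalideal P R" and "maximalideal M R"
  obtains \<pi> where "\<pi> \<in> carrier R" "\<pi> \<noteq> \<zero>" "M = PIdl \<pi>" "\<pi> \<notin> Units R"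
    "\<And>x. x \<in> carrier R - {\<zero>} \<Longrightarrow> \<exists>u \<in> Units R. \<exists>n :: nat. x = u \<otimes> \<pi> [^] n"
proof -
  obtain \<pi> where pi: "\<pi> \<in> carrier R" "M = PIdl \<pi>"
    using exists_gen[OF maximalideal.axioms(1)[OF assms(3)]] by blast
  have nz: "\<pi> \<noteq> \<zero>"
  proof
    assume "\<pi> = \<zero>"
    hence "M = {\<zero>}" using pi(2) cgenideal_ideal[OF zero_closed]
      additive_subgroup.zero_closed[OF ideal.axioms(1)] by (auto simp: cgenideal_def)
    hence "maximalideal {\<zero>} R" using assms(3) by (rule subst)
    thus False using assms(1) zeromaximalideal_fieldI by (elim notE)
  qed
  have nu: "\<pi> \<notin> Units R"
    using ideal_eq_carrier_iff[OF pi(1)] maximalideal.I_notcarr[OF assms(3)] pi(2) by auto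
  have uniq: "P = M" if "maximalideal P R" for P
    using assms(2) assms(3) that by (elim ex1E) metis
  \<comment> \<open>An irreducible element of a principal ideal domain generates a maximal ideal.
    There is only one, so all irreducibles are associates of \<pi> and a product of irreducibles
    collapses to a unit times a power of \<pi>.\<close>
  have irr: "\<exists>u \<in> Units R. p = u \<otimes> \<pi>" if "p \<in> carrier R" "ring_irreducible p" for p
  proof -
    have "PIdl p = PIdl \<pi>"
      using uniq[OF irreducible_imp_maximalideal[OF that]] pi(2)
      by simp
    hence "p \<sim> \<pi>" using associated_iff_same_ideal[OF that(1) pi(1)] by simp
    thus ?thesis using ring_associated_iff[OF that(1) pi(1)] by simp
  qed
  have prod: "\<exists>u \<in> Units R. \<exists>n :: nat. foldr (\<otimes>) fs \<one> = u \<otimes> \<pi> [^] n"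
    if "set fs \<subseteq> carrier R" "\<forall>f \<in> set fs. ring_irreducible f" for fs
    using that
  proof (induction fs)
    case Nil
    have "foldr (\<otimes>) [] \<one> = \<one> \<otimes> \<pi> [^] (0::nat)" by simp
    thus ?case by blast
  next
    case (Cons f fs)
    then obtain u n where u: "u \<in> Units R" "foldr (\<otimes>) fs \<one> = u \<otimes> \<pi> [^] (n::nat)" by auto
    obtain w where w: "w \<in> Units R" "f = w \<otimes> \<pi>" using irr Cons.prems by auto
    have "foldr (\<otimes>) (f # fs) \<one> = (w \<otimes> u) \<otimes> \<pi> [^] Suc n"
      using u w pi(1) Units_closed by (simp add: m_ac)
    thus ?case using u(1) w(1) by blast
  qed
  have "\<exists>u \<in> Units R. \<exists>n :: nat. x = u \<otimes> \<pi> [^] n" if x: "x \<in> carrier R - {\<zero>}" for x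
  proof -
    obtain fs where fs: "set fs \<subseteq> carrier (mult_of R)" "wfactors (mult_of R) fs x"
      using mult_of.wfactors_exist[of x] x by auto
    have "\<forall>f \<in> set fs. ring_irreducible f"
      using fs ring_irreducibleI' unfolding wfactors_def by auto
    then obtain u n where u: "u \<in> Units R" "foldr (\<otimes>) fs \<one> = u \<otimes> \<pi> [^] (n::nat)"
      using prod[of fs] fs(1) by auto
    let ?y = "foldr (\<otimes>) fs \<one>"
    have y: "?y \<in> carrier R" using u pi(1) by auto
    \<comment> \<open>\<open>wfactors\<close> yields x only up to association, which costs the
      further unit \<open>w\<close>.\<close>
    have "?y \<sim>\<^bsub>mult_of R\<^esub> x" using fs(2) unfolding wfactors_def by simp
    hence "?y \<sim> x" using assoc_iff_assoc_mult[OF y] x by simp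
    hence "\<exists>w \<in> Units R. x = w \<otimes> ?y"
      using ring_associated_iff[OF _ y, of x] associated_sym x by simp
    then obtain w where "w \<in> Units R" "x = w \<otimes> foldr (\<otimes>) fs \<one>" by blast
    hence "x = (w \<otimes> u) \<otimes> \<pi> [^] n" "w \<otimes> u \<in> Units R"
      using u pi(1) Units_closed by (auto simp: m_assoc)
    thus ?thesis by blast
  qed
  thus ?thesis using that pi nz nu by blast
qed

text \<open>An inverse inside the subring is also the inverse in the field. Units of S can thus be
  handled with the \<open>inv\<close> of the field, the one that occurs in
  \<open>B2\<close>.\<close>

lemma (in field) Units_subring:
  assumes "subring S R"
  shows "u \<in> Units (R\<lparr>carrier := S\<rparr>) \<longleftrightarrow> u \<in> S \<and> u \<noteq> \<zero> \<and> inv u \<in> S"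
proof
  assume u: "u \<in> Units (R\<lparr>carrier := S\<rparr>)"
  then obtain w where w: "w \<in> S" "w \<otimes> u = \<one>" "u \<otimes> w = \<one>" "u \<in> S" by (auto simp: Units_def)
  have c: "u \<in> carrier R" "w \<in> carrier R" using w subringE(1)[OF assms] by auto
  have "inv u = w" using w c by (metis inv_char)
  thus "u \<in> S \<and> u \<noteq> \<zero> \<and> inv u \<in> S" using w c by auto
next
  assume u: "u \<in> S \<and> u \<noteq> \<zero> \<and> inv u \<in> S"
  have "u \<in> Units R" using u subringE(1)[OF assms] field_Units by auto
  hence "inv u \<otimes> u = \<one>" "u \<otimes> inv u = \<one>" by auto
  thus "u \<in> Units (R\<lparr>carrier := S\<rparr>)" using u by (auto simp: Units_def[of "R\<lparr>carrier := S\<rparr>"])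
qed

text \<open>A ring endomorphism over K is determined by its values on a finite spanning list, and
  each value is a root of a polynomial over K that annihilates the generator.
  \<open>extensional\<close> turns agreement on the carrier into equality.\<close>

lemma (in field) finite_ring_homs_fixing_subfield:
  assumes "subfield K R" "finite_dimension K (carrier R)"
  shows "finite {h \<in> extensional (carrier R). h \<in> ring_hom R R \<and> (\<forall>x \<in> K. h x = x)}" (is "finite ?H")
proof -
  obtain Us where Us: "set Us \<subseteq> carrier R" "Span K Us = carrier R"
    using assms(2) exists_base[OF assms(1)] unfolding finite_dimension_def by metis
  have endo: "ring_hom_ring R R h" if "h \<in> ring_hom R R" for h
    using that ring_axioms by (intro ring_hom_ringI2)
  have K: "K \<subseteq> carrier R" using assms(1) subfieldE(3) by blast
  have orbit: "finite ((\<lambda>h. h x) ` ?H)" if x: "x \<in> carrier R" for x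
  proof -
    have "(algebraic over K) x"
      using finite_dimension_imp_algebraic[OF assms(1) carrier_is_subring assms(2) x] .
    then obtain p where p: "p \<in> carrier (univ_poly R K)" "p \<noteq> []" "eval p x = \<zero>"
      using algebraicE[OF subfieldE(1)[OF assms(1)] x] by blast
    have pK: "set p \<subseteq> K" and pR: "p \<in> carrier (poly_ring R)"
      using p(1,2) K unfolding sym[OF univ_poly_carrier] polynomial_def by auto
    have "(\<lambda>h. h x) ` ?H \<subseteq> {y. is_root p y}"
    proof clarify
      fix h assume h: "h \<in> ring_hom R R" "\<forall>x \<in> K. h x = x"
      have "map h p = p" using pK h(2) by (induct p) auto
      hence "eval p (h x) = h (eval p x)"
        using ring_hom_ring.eval_hom'[OF endo[OF h(1)], of x p] x pK K by auto
      thus "is_root p (h x)"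
        using p x ring_hom_zero[OF h(1) ring_axioms ring_axioms] ring_hom_closed[OF h(1) x]
        by (simp add: is_root_def)
    qed
    thus ?thesis using finite_number_of_roots[OF pR] by (rule finite_subset)
  qed
  \<comment> \<open>Each homomorphism is recorded by its list of values on \<open>Us\<close>; these
    lists have a fixed length and entries in the finite set \<open>?B\<close>.\<close>
  let ?B = "\<Union>x \<in> set Us. (\<lambda>h. h x) ` ?H"
  have "set (map h Us) \<subseteq> ?B" if "h \<in> ?H" for h
  proof
    fix y assume "y \<in> set (map h Us)"
    then obtain x where "x \<in> set Us" "y = h x" by auto
    thus "y \<in> ?B" using imageI[OF that, of "\<lambda>h. h x"] unfolding \<open>y = h x\<close> by (intro UN_I[OF \<open>x \<in> set Us\<close>])
  qed
  hence sub: "(\<lambda>h. map h Us) ` ?H \<subseteq> {ys. set ys \<subseteq> ?B \<and> length ys = length Us}"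
    by (intro image_subsetI CollectI conjI length_map)
  have "finite ?B" using orbit Us(1) by (intro finite_UN_I finite_set orbit) (rule subsetD)
  hence fin: "finite ((\<lambda>h. map h Us) ` ?H)"
    by (intro finite_subset[OF sub] finite_lists_length_eq)
  have "inj_on (\<lambda>h. map h Us) ?H"
  proof (rule inj_onI)
    fix g h assume g: "g \<in> ?H" and h: "h \<in> ?H" and eq: "map g Us = map h Us"
    have gh: "g \<in> ring_hom R R" "h \<in> ring_hom R R" "g \<in> extensional (carrier R)"
      "h \<in> extensional (carrier R)" and fx: "\<forall>x \<in> K. g x = x" "\<forall>x \<in> K. h x = x"
      using g h by auto
    have "g x = h x" if "x \<in> carrier R" for x
    proof -
      obtain Ks where Ks: "set Ks \<subseteq> K" "x = combine Ks Us"
        using \<open>x \<in> carrier R\<close>[folded Us(2)] unfolding Span_eq_combine_set[OF assms(1) Us(1)] by blast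
      have "map g Ks = Ks" "map h Ks = Ks" using Ks(1) fx by (auto intro: map_idI)
      moreover have "set Ks \<subseteq> carrier R" using Ks(1) K by blast
      ultimately show ?thesis
        using ring_hom_ring.combine_hom[OF endo[OF gh(1)] _ Us(1), of Ks]
          ring_hom_ring.combine_hom[OF endo[OF gh(2)] _ Us(1), of Ks] Ks(2) eq by simp
    qed
    thus "g = h" by (intro extensionalityI[OF gh(3,4)])
  qed
  thus ?thesis by (rule finite_imageD[OF fin])
qed

section \<open>The valuation on an unramified integral extension\<close>

lemma (in ring) eval_in_subring:
  assumes "subring S R" "set p \<subseteq> S" "x \<in> S"
  shows "eval p x \<in> S"
  using ring.eval_in_carrier[OF subring_is_ring[OF assms(1)], of p x] assms by simp

lemma (in ring) subring_pow:
  assumes "subring S R" "x \<in> S"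
  shows "x [^] (n :: nat) \<in> S"
  using assms(2) subringE(3,6)[OF assms(1)] by (induct n) auto

text \<open>In a monic equation for x the constant term is -x times the value of the remaining
  quotient polynomial. If it vanishes, x cancels and the degree drops. The induction runs from the
  right because the constant term is the last entry of the coefficient list.\<close>

lemma (in domain) integral_divides_base:
  assumes S: "subring S R" and A: "A \<subseteq> S" and x: "x \<in> S" "x \<noteq> \<zero>"
    and p: "p \<noteq> []" "set p \<subseteq> A" "hd p = \<one>" "eval p x = \<zero>"
  shows "\<exists>c \<in> A - {\<zero>}. \<exists>s \<in> S. c = x \<otimes> s"
  using p
proof (induction p rule: rev_induct)
  case (snoc c p)
  have car: "S \<subseteq> carrier R" using subringE(1)[OF S] .
  have c: "c \<in> carrier R" and pc: "set p \<subseteq> carrier R" and xc: "x \<in> carrier R" and pS: "set p \<subseteq> S"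
    using snoc.prems(2) A car x by auto
  have e: "eval p x \<in> S" using eval_in_subring[OF S pS x(1)] .
  hence ec: "eval p x \<in> carrier R" using car by auto
  have eq: "eval p x \<otimes> x \<oplus> c = \<zero>"
    using snoc.prems(4) eval_append_aux[OF pc c xc] by simp
  show ?case
  proof (cases "c = \<zero>")
    case True
    hence "eval p x = \<zero>" using eq ec xc x(2) integral by auto
    \<comment> \<open>For p = [] the entry c would be the leading coefficient \<one>, against c =
      \<zero>.\<close>
    moreover have "p \<noteq> []" using snoc.prems(3) True by auto
    ultimately show ?thesis using snoc by auto
  next
    case False
    have "c = x \<otimes> (\<ominus> eval p x)"
      using eq ec xc c by (metis m_comm minus_equality r_minus sum_zero_eq_neg a_comm m_closed minus_minus)
    thus ?thesis using False snoc.prems(2) e subringE(5)[OF S] by auto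
  qed
qed simp

text \<open>With \<open>w = 1 - q z\<close>, this rewrites the homogenized polynomial by \<open>q z = 1 - w\<close>. When \<open>z\<close> is a
  root, \<open>w\<close> divides \<open>1 + q d\<close>, which is a unit if \<open>q\<close> generates the maximal ideal of a local
  ring \<open>A\<close>; this makes \<open>S\<close> local without appeal to completeness.\<close>

lemma (in cring) integral_one_minus_multiple:
  assumes S: "subring S R" and A: "subring A R" "A \<subseteq> S" and q: "q \<in> A" and z: "z \<in> S"
    and p: "p \<noteq> []" "set p \<subseteq> A" "hd p = \<one>"
  shows "\<exists>d \<in> A. \<exists>s \<in> S.
    q [^] (length p - 1) \<otimes> eval p z = \<one> \<oplus> q \<otimes> d \<oplus> (\<one> \<ominus> q \<otimes> z) \<otimes> s"
  using p
proof (induction p rule: rev_induct)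
  case (snoc c p)
  note SE = subringE[OF S] and AE = subringE[OF A(1)]
  have c: "c \<in> A" and pS: "set p \<subseteq> S" using snoc.prems(2) A(2) by auto
  show ?case
  proof (cases "p = []")
    case True
    hence "c = \<one>" using snoc.prems by simp
    hence "q [^] (length (p @ [c]) - 1) \<otimes> eval (p @ [c]) z = \<one> \<oplus> q \<otimes> \<zero> \<oplus> (\<one> \<ominus> q \<otimes> z) \<otimes> \<zero>"
      using True q z AE(1) SE(1) by (auto simp: a_minus_def subset_iff)
    thus ?thesis using SE(2) AE(2) by blast
  next
    case False
    let ?n = "length p - 1" and ?w = "\<one> \<ominus> q \<otimes> z" and ?e = "eval p z"
    obtain d s where ds: "d \<in> A" "s \<in> S" "q [^] ?n \<otimes> ?e = \<one> \<oplus> q \<otimes> d \<oplus> ?w \<otimes> s"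
      using snoc False by auto
    have n: "length (p @ [c]) - 1 = Suc ?n" using False by simp
    have qn: "q [^] ?n \<in> A" using subring_pow[OF A(1) q] .
    have carr: "q \<in> carrier R" "z \<in> carrier R" "c \<in> carrier R" "d \<in> carrier R" "s \<in> carrier R"
      "?e \<in> carrier R" "q [^] ?n \<in> carrier R"
      using q z c ds A(2) SE(1) qn eval_in_subring[OF S pS z] by auto
    have "q [^] (length (p @ [c]) - 1) \<otimes> eval (p @ [c]) z
        = (q [^] ?n \<otimes> q) \<otimes> (?e \<otimes> z \<oplus> c)"
    proof -
      have "eval (p @ [c]) z = ?e \<otimes> z \<oplus> c"
        using eval_append_aux[of p c z] carr pS SE(1) by blast
      thus ?thesis unfolding n by simp
    qed
    also have "\<dots> = (q [^] ?n \<otimes> ?e) \<otimes> (q \<otimes> z) \<oplus> q \<otimes> (q [^] ?n \<otimes> c)"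
      using carr by algebra
    also have "\<dots> = (\<one> \<oplus> q \<otimes> d \<oplus> ?w \<otimes> s) \<otimes> (q \<otimes> z) \<oplus> q \<otimes> (q [^] ?n \<otimes> c)"
      using ds(3) by simp
    \<comment> \<open>Since q z = 1 - w, the product (1 + q d)(q z) equals (1 + q d) - w (1 + q d):
      the shape 1 + q d survives and the correction goes into the cofactor of w.\<close>
    also have "\<dots> = \<one> \<oplus> q \<otimes> (d \<oplus> q [^] ?n \<otimes> c)
        \<oplus> ?w \<otimes> (s \<otimes> (q \<otimes> z) \<oplus> \<ominus> (\<one> \<oplus> q \<otimes> d))"
      using carr by algebra
    finally have "q [^] (length (p @ [c]) - 1) \<otimes> eval (p @ [c]) z
       = \<one> \<oplus> q \<otimes> (d \<oplus> q [^] ?n \<otimes> c) \<oplus> ?w \<otimes> (s \<otimes> (q \<otimes> z) \<oplus> \<ominus> (\<one> \<oplus> q \<otimes> d))" .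
    moreover have "d \<oplus> q [^] ?n \<otimes> c \<in> A" using ds c qn AE by auto
    moreover have "s \<otimes> (q \<otimes> z) \<oplus> \<ominus> (\<one> \<oplus> q \<otimes> d) \<in> S"
      using ds q z A(2) SE(3,5,6,7) by (simp add: subset_iff)
    ultimately show ?thesis by blast
  qed
qed simp

text \<open>Once the nonunits of S are known to be multiples of \<pi>, x is divided by \<pi> until a
  unit remains. A multiple u \<pi>^n of x in A bounds the number of divisions.\<close>

lemma (in field) integral_extension_uniformizer:
  assumes A: "subring A R" and S: "subring S R" and AS: "A \<subseteq> S"
    and int: "\<And>x. x \<in> S \<Longrightarrow> \<exists>p. p \<noteq> [] \<and> set p \<subseteq> A \<and> hd p = \<one> \<and> eval p x = \<zero>"
    and pi: "\<pi> \<in> A" "\<pi> \<noteq> \<zero>" "\<pi> \<notin> Units (R\<lparr>carrier := A\<rparr>)"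
    and A_fac: "\<And>x. x \<in> A - {\<zero>} \<Longrightarrow> \<exists>u \<in> Units (R\<lparr>carrier := A\<rparr>). \<exists>n :: nat. x = u \<otimes> \<pi> [^] n"
    and max: "maximalideal {s \<otimes> \<pi> | s. s \<in> S} (R\<lparr>carrier := S\<rparr>)"
    and x: "x \<in> S - {\<zero>}"
  shows "\<exists>u \<in> Units (R\<lparr>carrier := S\<rparr>). \<exists>n :: nat. x = u \<otimes> \<pi> [^] n"
proof -
  let ?S = "R\<lparr>carrier := S\<rparr>" and ?J = "{s \<otimes> \<pi> | s. s \<in> S}"
  note SE = subringE[OF S] and AE = subringE[OF A]
  interpret S: cring ?S using subcring_iff[OF SE(1)] subcringI'[OF S] by simp
  interpret J: maximalideal ?J ?S by (rule max)
  note UA = Units_subring[OF A] and US = Units_subring[OF S]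
  have piS: "\<pi> \<in> S" and pic: "\<pi> \<in> carrier R" using pi AS SE(1) by auto
  have USI: "y \<in> Units ?S" if "y \<in> S" "w \<in> S" "y \<otimes> w = \<one>" for y w
  proof -
    have "w \<otimes> y = \<one>" using that SE(1) m_comm[of w y] by auto
    thus ?thesis using that by (auto simp: Units_def)
  qed
  have UA_US: "u \<in> Units ?S" if "u \<in> Units (R\<lparr>carrier := A\<rparr>)" for u
    using that AS by (auto simp: UA US)
  \<comment> \<open>From 1 + \<pi> d = e \<pi> the element e - d would be an inverse of \<pi>. So
    \<pi> does not divide 1 + \<pi> d, and the exponent in its factorization is 0. The case e = 0
    shows that it is nonzero.\<close>
  have A_local: "\<one> \<oplus> \<pi> \<otimes> d \<in> Units (R\<lparr>carrier := A\<rparr>)" if d: "d \<in> A" for d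
  proof -
    have dc: "d \<in> carrier R" using d AE(1) by auto
    have no: "\<one> \<oplus> \<pi> \<otimes> d \<noteq> e \<otimes> \<pi>" if e: "e \<in> A" for e
    proof
      assume eq: "\<one> \<oplus> \<pi> \<otimes> d = e \<otimes> \<pi>"
      have ec: "e \<in> carrier R" using e AE(1) by auto
      have "\<pi> \<otimes> (e \<oplus> \<ominus> d) = \<one>"
      proof -
        have "\<pi> \<otimes> (e \<oplus> \<ominus> d) = (e \<otimes> \<pi>) \<ominus> \<pi> \<otimes> d" using pic dc ec by algebra
        also have "\<dots> = \<one>" unfolding eq[symmetric] using pic dc by algebra
        finally show ?thesis .
      qed
      moreover have "e \<oplus> \<ominus> d \<in> A" using d e AE by auto
      ultimately have "\<pi> \<in> Units (R\<lparr>carrier := A\<rparr>)"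
        using pi(1) pic m_comm[of \<pi> "e \<oplus> \<ominus> d"] dc ec by (auto simp: Units_def)
      thus False using pi(3) by simp
    qed
    have "\<one> \<oplus> \<pi> \<otimes> d \<in> A" using d pi(1) AE by auto
    moreover have "\<one> \<oplus> \<pi> \<otimes> d \<noteq> \<zero>" using no[OF AE(2)] pic by auto
    ultimately obtain u n where u: "u \<in> Units (R\<lparr>carrier := A\<rparr>)" "\<one> \<oplus> \<pi> \<otimes> d = u \<otimes> \<pi> [^] (n::nat)"
      using A_fac by blast
    have uA: "u \<in> A" "u \<in> carrier R" using u(1) UA AE(1) by auto
    have "n = 0"
    proof (rule ccontr)
      assume "n \<noteq> 0"
      then obtain m where n: "n = Suc m" using not0_implies_Suc by blast
      have "\<pi> [^] m \<in> A" using subring_pow[OF A pi(1)] .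
      hence "u \<otimes> \<pi> [^] m \<in> A" using uA AE by auto
      moreover have "u \<otimes> \<pi> [^] n = (u \<otimes> \<pi> [^] m) \<otimes> \<pi>" using n uA pic by (simp add: m_assoc)
      ultimately show False using no u(2) by metis
    qed
    thus ?thesis using u uA by simp
  qed
  have S_local: "\<one> \<ominus> \<pi> \<otimes> z \<in> Units ?S" if z: "z \<in> S" for z
  proof -
    let ?w = "\<one> \<ominus> \<pi> \<otimes> z"
    have zc: "z \<in> carrier R" using z SE(1) by auto
    have w: "?w \<in> S" using z piS SE by (simp add: a_minus_def)
    have wc: "?w \<in> carrier R" using w SE(1) by auto
    obtain p where p: "p \<noteq> []" "set p \<subseteq> A" "hd p = \<one>" "eval p z = \<zero>" using int[OF z] by blast
    obtain d s where ds: "d \<in> A" "s \<in> S"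
      "\<pi> [^] (length p - 1) \<otimes> eval p z = \<one> \<oplus> \<pi> \<otimes> d \<oplus> ?w \<otimes> s"
      using integral_one_minus_multiple[OF S A AS pi(1) z p(1-3)] by blast
    have dsc: "d \<in> carrier R" "s \<in> carrier R" using ds AE(1) SE(1) by auto
    let ?u = "\<one> \<oplus> \<pi> \<otimes> d"
    have u: "?u \<in> Units ?S" using A_local[OF ds(1)] UA_US by blast
    hence uc: "?u \<in> S" "inv ?u \<in> S" "?u \<noteq> \<zero>" using US by auto
    hence uc': "?u \<in> carrier R" "inv ?u \<in> carrier R" using SE(1) by auto
    have "?u \<oplus> ?w \<otimes> s = \<zero>" using ds(3) p(4) pic by simp
    hence "?u = ?w \<otimes> (\<ominus> s)" using uc' wc dsc
      by (metis m_closed minus_equality r_minus minus_minus)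
    moreover have "?u \<otimes> inv ?u = \<one>" using uc(3) uc'(1) field_Units by auto
    ultimately have "?w \<otimes> (\<ominus> s \<otimes> inv ?u) = \<one>" using wc dsc uc' by (metis m_assoc a_inv_closed)
    thus ?thesis using USI[OF w] ds(2) uc SE(5,6) by blast
  qed
  \<comment> \<open>Here \<pi> S becomes the set of all nonunits: the ideal generated by \<pi> and a
    nonunit y is still proper, so by maximality it is \<pi> S itself.\<close>
  have nonunit: "y \<in> ?J \<or> y \<in> Units ?S" if y: "y \<in> S" for y
  proof (rule disjCI)
    assume "y \<notin> Units ?S"
    have yc: "y \<in> carrier R" using y SE(1) by auto
    have I: "ideal (?J <+>\<^bsub>?S\<^esub> PIdl\<^bsub>?S\<^esub> y) ?S"
      using S.add_ideals[OF J.is_ideal S.cgenideal_ideal] y by simp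
    have mem: "k \<in> ?J <+>\<^bsub>?S\<^esub> PIdl\<^bsub>?S\<^esub> y \<longleftrightarrow> (\<exists>s \<in> S. \<exists>t \<in> S. k = s \<otimes> \<pi> \<oplus> t \<otimes> y)" for k
      by (auto simp: set_add_def' cgenideal_def)
    have "?J \<subseteq> ?J <+>\<^bsub>?S\<^esub> PIdl\<^bsub>?S\<^esub> y"
    proof
      fix k assume "k \<in> ?J"
      then obtain s where s: "s \<in> S" "k = s \<otimes> \<pi>" by blast
      hence "k = s \<otimes> \<pi> \<oplus> \<zero> \<otimes> y" using pic yc SE(1) by auto
      thus "k \<in> ?J <+>\<^bsub>?S\<^esub> PIdl\<^bsub>?S\<^esub> y" unfolding mem using s SE(2) by blast
    qed
    hence "?J <+>\<^bsub>?S\<^esub> PIdl\<^bsub>?S\<^esub> y = ?J \<or> ?J <+>\<^bsub>?S\<^esub> PIdl\<^bsub>?S\<^esub> y = S"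
      using J.I_maximal[OF I] ideal.Icarr[OF I] by auto
    \<comment> \<open>Otherwise y t = 1 - \<pi> s for some s and t in S. This is a unit by
      \<open>S_local\<close>, and then so is y.\<close>
    moreover have "\<one> \<notin> ?J <+>\<^bsub>?S\<^esub> PIdl\<^bsub>?S\<^esub> y"
    proof
      assume "\<one> \<in> ?J <+>\<^bsub>?S\<^esub> PIdl\<^bsub>?S\<^esub> y"
      then obtain s t where st: "s \<in> S" "t \<in> S" "\<one> = s \<otimes> \<pi> \<oplus> t \<otimes> y" using mem by blast
      hence stc: "s \<in> carrier R" "t \<in> carrier R" using SE(1) by auto
      have "\<one> \<ominus> \<pi> \<otimes> s = y \<otimes> t"
      proof -
        have "\<one> \<ominus> \<pi> \<otimes> s = (s \<otimes> \<pi> \<oplus> t \<otimes> y) \<ominus> \<pi> \<otimes> s" using st(3) by simp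
        also have "\<dots> = y \<otimes> t" using stc yc pic by algebra
        finally show ?thesis .
      qed
      hence "y \<otimes> t \<in> Units ?S" using S_local[OF st(1)] by simp
      hence "y \<otimes> t \<otimes> inv (y \<otimes> t) = \<one>" "inv (y \<otimes> t) \<in> S"
        using US field_Units yc stc by auto
      hence "y \<otimes> (t \<otimes> inv (y \<otimes> t)) = \<one>" "t \<otimes> inv (y \<otimes> t) \<in> S"
        using yc stc SE(1,6) st(2) by (auto simp: m_assoc subset_iff)
      thus False using USI y \<open>y \<notin> Units ?S\<close> by blast
    qed
    ultimately have eq: "?J <+>\<^bsub>?S\<^esub> PIdl\<^bsub>?S\<^esub> y = ?J" using SE(3) by auto
    have "y = \<zero> \<otimes> \<pi> \<oplus> \<one> \<otimes> y" using pic yc by simp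
    hence "y \<in> ?J <+>\<^bsub>?S\<^esub> PIdl\<^bsub>?S\<^esub> y" unfolding mem using SE(2,3) by blast
    thus "y \<in> ?J" using eq by simp
  qed
  \<comment> \<open>The invariant is that y divides u \<pi>^k. Cancelling a factor \<pi> of y lowers
    k and keeps t and u; at k = 0 the element y divides a unit.\<close>
  have descent: "\<exists>u \<in> Units ?S. \<exists>n :: nat. y = u \<otimes> \<pi> [^] n"
    if "y \<in> S" "t \<in> S" "u \<in> Units ?S" "y \<otimes> t = u \<otimes> \<pi> [^] (k :: nat)" for y t u k
    using that
  proof (induction k arbitrary: y)
    case 0
    have c: "y \<in> carrier R" "t \<in> carrier R" "u \<in> carrier R" "inv u \<in> carrier R"
      using 0 US SE(1) by auto
    have "y \<otimes> (t \<otimes> inv u) = u \<otimes> inv u" using 0(4) c by (simp add: m_assoc[symmetric])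
    also have "\<dots> = \<one>" using 0(3) US c field_Units by auto
    finally have "y \<in> Units ?S" using USI 0 US SE(6) by blast
    moreover have "y = y \<otimes> \<pi> [^] (0::nat)" using c by simp
    ultimately show ?case by blast
  next
    case (Suc k)
    show ?case
    proof (cases "y \<in> Units ?S")
      case True
      moreover have "y = y \<otimes> \<pi> [^] (0::nat)" using Suc.prems SE(1) by auto
      ultimately show ?thesis by blast
    next
      case False
      then obtain s where s: "s \<in> S" "y = s \<otimes> \<pi>" using nonunit[OF Suc.prems(1)] by blast
      have c: "s \<in> carrier R" "t \<in> carrier R" "u \<in> carrier R"
        using Suc.prems US SE(1) s by auto
      have "\<pi> \<otimes> (s \<otimes> t) = \<pi> \<otimes> (u \<otimes> \<pi> [^] k)"
        using Suc.prems(4) s(2) c pic by (simp add: m_ac)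
      hence "s \<otimes> t = u \<otimes> \<pi> [^] k" using pi(2) pic c m_lcancel by auto
      then obtain v n where v: "v \<in> Units ?S" "s = v \<otimes> \<pi> [^] (n::nat)"
        using Suc.IH[OF s(1) Suc.prems(2,3)] by blast
      have "v \<in> carrier R" using v US SE(1) by auto
      hence "y = v \<otimes> \<pi> [^] Suc n" using s v pic by (simp add: m_assoc)
      thus ?thesis using v(1) by blast
    qed
  qed
  obtain p where p: "p \<noteq> []" "set p \<subseteq> A" "hd p = \<one>" "eval p x = \<zero>" using int x by blast
  obtain c s where c: "c \<in> A - {\<zero>}" "s \<in> S" "c = x \<otimes> s"
    using integral_divides_base[OF S AS _ _ p] x by blast
  obtain u n where u: "u \<in> Units (R\<lparr>carrier := A\<rparr>)" "c = u \<otimes> \<pi> [^] (n::nat)" using A_fac[OF c(1)] by blast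
  show ?thesis using descent[OF _ c(2) UA_US[OF u(1)], of x n] x c(3) u(2) by auto
qed

section \<open>Quotients of monoids by the kernel relation\<close>

text \<open>Without inverses the fibres of a homomorphism are not governed by the preimage of the
  unit, so \<open>ker\<close> compares cosets with values of f directly. The classes are then the
  fibres of f, indexed by N through \<open>g\<close>, and the monoid laws are carried over from
  N.\<close>

lemma quotient_monoid_kernel_iso:
  fixes A :: "('c, 'd) monoid_scheme" and N :: "('e, 'f) monoid_scheme"
  assumes N: "monoid N"
    and closed: "\<And>x y. x \<in> carrier A \<Longrightarrow> y \<in> carrier A \<Longrightarrow> x \<otimes>\<^bsub>A\<^esub> y \<in> carrier A"
    and one: "\<one>\<^bsub>A\<^esub> \<in> carrier A" "f \<one>\<^bsub>A\<^esub> = \<one>\<^bsub>N\<^esub>"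
    and hom: "\<And>x y. x \<in> carrier A \<Longrightarrow> y \<in> carrier A \<Longrightarrow> f (x \<otimes>\<^bsub>A\<^esub> y) = f x \<otimes>\<^bsub>N\<^esub> f y"
    and surj: "f ` carrier A = carrier N"
    and ker: "\<And>x y. x \<in> carrier A \<Longrightarrow> y \<in> carrier A \<Longrightarrow> x <#\<^bsub>A\<^esub> H = y <#\<^bsub>A\<^esub> H \<longleftrightarrow> f x = f y"
  shows "monoid (quotient_monoid A H) \<and>
    (\<exists>\<phi> \<in> iso (quotient_monoid A H) N. \<phi> \<one>\<^bsub>quotient_monoid A H\<^esub> = \<one>\<^bsub>N\<^esub>)"
proof -
  interpret N: monoid N by (rule N)
  let ?Q = "quotient_monoid A H"
  define g where "g = (\<lambda>n. {x \<in> carrier A. f x = n})"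
  have rel: "coset_rel A H `` {x} = g (f x)" if "x \<in> carrier A" for x
    using that ker by (auto simp: coset_rel_def g_def)
  have car: "carrier ?Q = g ` carrier N"
  proof -
    have "carrier ?Q = (\<lambda>x. g (f x)) ` carrier A"
      using rel by (auto simp: quotient_monoid_def quotient_def)
    also have "\<dots> = g ` carrier N" unfolding surj[symmetric] image_image ..
    finally show ?thesis .
  qed
  have mult: "g m \<otimes>\<^bsub>?Q\<^esub> g n = g (m \<otimes>\<^bsub>N\<^esub> n)" if mn: "m \<in> carrier N" "n \<in> carrier N" for m n
  proof -
    have "coset_rel A H `` {x \<otimes>\<^bsub>A\<^esub> y} = g (m \<otimes>\<^bsub>N\<^esub> n)" if "x \<in> g m" "y \<in> g n" for x y
      using that rel[OF closed] hom by (auto simp: g_def)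
    \<comment> \<open>The product of classes is a union over their elements, which would be empty
      for an empty fibre; surjectivity excludes this.\<close>
    moreover have "g k \<noteq> {}" if "k \<in> carrier N" for k
      using that unfolding surj[symmetric] g_def by auto
    then have "g m \<noteq> {}" "g n \<noteq> {}" using mn by auto
    ultimately show ?thesis by (auto simp: quotient_monoid_def)
  qed
  have onQ: "\<one>\<^bsub>?Q\<^esub> = g \<one>\<^bsub>N\<^esub>" using rel one by (simp add: quotient_monoid_def)
  have inj: "inj_on g (carrier N)"
  proof (rule inj_onI)
    fix m n assume m: "m \<in> carrier N" and eq: "g m = g n"
    obtain x where "x \<in> carrier A" "f x = m" using m unfolding surj[symmetric] by blast
    moreover from this have "x \<in> g n" unfolding eq[symmetric] by (simp add: g_def)
    ultimately show "m = n" by (simp add: g_def)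
  qed
  define h where "h = inv_into (carrier N) g"
  have hg: "h (g n) = n" if "n \<in> carrier N" for n
    using inv_into_f_f[OF inj that] by (simp add: h_def)
  have "monoid ?Q"
    by (rule monoidI) (auto simp: car mult onQ N.m_assoc)
  moreover have "h \<in> iso ?Q N"
  proof (rule isoI)
    show "h \<in> hom ?Q N" by (auto simp: hom_def car hg mult)
    show "bij_betw h (carrier ?Q) (carrier N)"
      using inj unfolding car h_def by (simp add: bij_betw_inv_into inj_on_imp_bij_betw)
  qed
  moreover have "h \<one>\<^bsub>?Q\<^esub> = \<one>\<^bsub>N\<^esub>" by (simp add: onQ hg)
  ultimately show ?thesis by blast
qed

lemma monoid_Sl:
  assumes "monoid G"
  shows "monoid (Sl G)"
proof -
  interpret monoid G by (rule assms)
  show ?thesis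
  proof (rule monoidI)
    fix r s assume "r \<in> carrier (Sl G)" "s \<in> carrier (Sl G)"
    thus "r \<otimes>\<^bsub>Sl G\<^esub> s \<in> carrier (Sl G)"
      by (auto simp: Sl_def) (metis add_mono add.assoc add.left_commute)
  qed (auto simp: Sl_def PiE_def extensional_def fun_eq_iff)
qed

section \<open>Coboundaries and valuations\<close>

text \<open>What the cocycle argument takes from the arithmetic: a nonunit \<pi> with factorizations
  x = u \<pi>^n in S, and a finite monoid whose elements are ring endomorphisms of L that preserve S
  and fix \<pi>.\<close>

locale galois_valuation = field L for L (structure) +
  fixes S :: "'a set" and \<pi> :: 'a and G :: "('a \<Rightarrow> 'a) monoid"
  assumes S: "subring S L"
    and pi: "\<pi> \<in> S" "\<pi> \<noteq> \<zero>" "\<pi> \<notin> Units (L\<lparr>carrier := S\<rparr>)"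
    and factor: "x \<in> S - {\<zero>} \<Longrightarrow> \<exists>u \<in> Units (L\<lparr>carrier := S\<rparr>). \<exists>n :: nat. x = u \<otimes> \<pi> [^] n"
    and G: "monoid G" "finite (carrier G)"
    and action_hom: "\<alpha> \<in> carrier G \<Longrightarrow> \<alpha> \<in> ring_hom L L"
    and action_closed: "\<alpha> \<in> carrier G \<Longrightarrow> x \<in> S \<Longrightarrow> \<alpha> x \<in> S"
    and action_pi: "\<alpha> \<in> carrier G \<Longrightarrow> \<alpha> \<pi> = \<pi>"
begin

interpretation G: monoid G by (rule G(1))

section \<open>Units of S and the valuation defined by \<pi>\<close>

abbreviation "U \<equiv> Units (L\<lparr>carrier := S\<rparr>)"
abbreviation "S' \<equiv> S - {\<zero>}"

text \<open>Meaningful on \<open>S'\<close>, where \<open>factor\<close> gives existence and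
  \<open>factor_unique\<close> uniqueness; at zero no exponent fits and the value is
  arbitrary.\<close>

definition val :: "'a \<Rightarrow> nat" where
  "val x = (THE n. \<exists>u \<in> U. x = u \<otimes> \<pi> [^] n)"

lemmas U_iff = Units_subring[OF S]

lemma S_carrier: "x \<in> S \<Longrightarrow> x \<in> carrier L"
  using subringE(1)[OF S] by auto

lemma S'_carrier [simp]: "x \<in> S' \<Longrightarrow> x \<in> carrier L" "x \<in> S' \<Longrightarrow> x \<noteq> \<zero>"
  using S_carrier by auto

lemma inv_nonzero [simp]: "x \<in> carrier L \<Longrightarrow> x \<noteq> \<zero> \<Longrightarrow> inv x \<in> carrier L"
  "x \<in> carrier L \<Longrightarrow> x \<noteq> \<zero> \<Longrightarrow> inv x \<noteq> \<zero>"
  using field_Units by auto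

lemma r_inv_nonzero [simp]: "x \<in> carrier L \<Longrightarrow> x \<noteq> \<zero> \<Longrightarrow> x \<otimes> inv x = \<one>"
  using field_Units by auto

lemma l_inv_nonzero [simp]: "x \<in> carrier L \<Longrightarrow> x \<noteq> \<zero> \<Longrightarrow> inv x \<otimes> x = \<one>"
  using field_Units by auto

lemma mult_inv_eq_iff:
  assumes "x \<in> carrier L" "z \<in> carrier L" "y \<in> carrier L" "y \<noteq> \<zero>"
  shows "x \<otimes> inv y = z \<longleftrightarrow> x = z \<otimes> y"
  using assms by (metis inv_nonzero(1) l_inv_nonzero m_assoc r_inv_nonzero r_one)

lemma inv_mult_nonzero [simp]:
  assumes "x \<in> carrier L" "x \<noteq> \<zero>" "y \<in> carrier L" "y \<noteq> \<zero>"
  shows "inv (x \<otimes> y) = inv x \<otimes> inv y"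
proof (rule inv_unique'[symmetric])
  show "x \<otimes> y \<otimes> (inv x \<otimes> inv y) = \<one>"
  proof -
    have "x \<otimes> y \<otimes> (inv x \<otimes> inv y) = (x \<otimes> inv x) \<otimes> (y \<otimes> inv y)"
      using assms inv_nonzero by (simp add: m_ac del: r_inv_nonzero)
    thus ?thesis using assms by simp
  qed
  thus "inv x \<otimes> inv y \<otimes> (x \<otimes> y) = \<one>" using assms by (simp add: m_comm)
qed (use assms in auto)

text \<open>Values of coboundaries are fractions in L, whereas \<open>val\<close> is additive only
  on \<open>S'\<close>. Clearing denominators makes \<open>val_mult\<close> applicable.\<close>

lemma cross_multiply:
  assumes "x \<in> S'" "y \<in> S'" "z \<in> S'" "w \<in> S'" "x \<otimes> inv z = y \<otimes> inv w"
  shows "x \<otimes> w = y \<otimes> z"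
proof -
  note c = assms(1-4)[THEN S'_carrier(1)] assms(1-4)[THEN S'_carrier(2)]
  have "x = y \<otimes> inv w \<otimes> z" using assms(5) c mult_inv_eq_iff by simp
  hence "x \<otimes> w = (y \<otimes> inv w \<otimes> z) \<otimes> w" by simp
  also have "\<dots> = y \<otimes> z \<otimes> (inv w \<otimes> w)"
    using c by (simp add: m_ac del: l_inv_nonzero r_inv_nonzero)
  finally show ?thesis using c by simp
qed

lemma U_S': "u \<in> U \<Longrightarrow> u \<in> S'"
  by (auto simp: U_iff)

lemma S'_mult: "x \<in> S' \<Longrightarrow> y \<in> S' \<Longrightarrow> x \<otimes> y \<in> S'"
  using subringE(6)[OF S] integral S_carrier by blast

lemma one_U: "\<one> \<in> U"
  using subringE(3)[OF S] by (simp add: U_iff)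

lemma U_mult: "u \<in> U \<Longrightarrow> v \<in> U \<Longrightarrow> u \<otimes> v \<in> U"
  using S'_mult[OF U_S' U_S', of u v] subringE(6)[OF S] U_S' by (simp add: U_iff)

lemma U_inv: "u \<in> U \<Longrightarrow> inv u \<in> U"
  using comm_inv_char[of "inv u" u] S_carrier by (auto simp: U_iff)

lemma pi_pow: "\<pi> [^] (n::nat) \<in> S'"
  using pi one_U U_S' S'_mult by (induct n) auto

text \<open>For m < n, cancelling \<pi>^m would make \<pi> a divisor of the unit u, hence a
  unit.\<close>

lemma factor_unique:
  assumes "u \<in> U" "v \<in> U" "u \<otimes> \<pi> [^] (m::nat) = v \<otimes> \<pi> [^] (n::nat)"
  shows "m = n"
proof -
  have *: "\<not> m < n" if "u \<in> U" "v \<in> U" "u \<otimes> \<pi> [^] m = v \<otimes> \<pi> [^] n" for u v and m n :: nat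
  proof
    assume "m < n"
    then obtain k where n: "n = m + Suc k" using less_iff_Suc_add by auto
    note c = S'_carrier[OF U_S'[OF that(1)]] S'_carrier[OF U_S'[OF that(2)]]
      S'_carrier[OF pi_pow[of m]] S'_carrier[OF pi_pow[of k]] S_carrier[OF pi(1)]
    have "\<pi> [^] m \<otimes> u = \<pi> [^] m \<otimes> (\<pi> \<otimes> (v \<otimes> \<pi> [^] k))"
      using that(3) c unfolding n by (simp add: nat_pow_mult[symmetric] m_ac)
    hence u: "u = \<pi> \<otimes> (v \<otimes> \<pi> [^] k)" using c m_lcancel by auto
    have "inv u = inv \<pi> \<otimes> (inv v \<otimes> inv (\<pi> [^] k))"
      unfolding u using c pi(2) integral by (auto simp: integral_iff)
    hence "inv \<pi> = (v \<otimes> \<pi> [^] k) \<otimes> inv u"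
      using c pi(2) by (simp add: m_ac)
    moreover have "(v \<otimes> \<pi> [^] k) \<otimes> inv u \<in> S"
      using S'_mult[OF S'_mult[OF U_S'[OF that(2)] pi_pow] U_S'[OF U_inv[OF that(1)]]] by simp
    ultimately have "\<pi> \<in> U" using pi by (simp add: U_iff)
    thus False using pi(3) by simp
  qed
  show ?thesis using *[OF assms] *[OF assms(2,1) assms(3)[symmetric]] by simp
qed

lemma val_eq:
  assumes "u \<in> U"
  shows "val (u \<otimes> \<pi> [^] (n::nat)) = n"
  unfolding val_def
proof (rule the_equality)
  show "\<exists>v \<in> U. u \<otimes> \<pi> [^] n = v \<otimes> \<pi> [^] n" using assms by blast
next
  fix m :: nat assume "\<exists>v \<in> U. u \<otimes> \<pi> [^] n = v \<otimes> \<pi> [^] m"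
  thus "m = n" using factor_unique[OF assms] by auto
qed

lemma factorE:
  assumes "x \<in> S'"
  obtains u where "u \<in> U" "x = u \<otimes> \<pi> [^] val x"
  using factor[OF assms] val_eq by metis

lemma val_unit: "u \<in> U \<Longrightarrow> val u = 0"
  using val_eq[of u 0] U_S' by simp

lemma val_pi_pow: "val (\<pi> [^] (n::nat)) = n"
  using val_eq[OF one_U, of n] pi_pow by simp

lemma val_mult:
  assumes "x \<in> S'" "y \<in> S'"
  shows "val (x \<otimes> y) = val x + val y"
proof -
  obtain u v where u: "u \<in> U" "x = u \<otimes> \<pi> [^] val x" and v: "v \<in> U" "y = v \<otimes> \<pi> [^] val y"
    using factorE assms by metis
  note c = S'_carrier[OF U_S'[OF u(1)]] S'_carrier[OF U_S'[OF v(1)]] S_carrier[OF pi(1)]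
  have "(u \<otimes> \<pi> [^] val x) \<otimes> (v \<otimes> \<pi> [^] val y) = (u \<otimes> v) \<otimes> \<pi> [^] (val x + val y)"
    using c by (simp add: nat_pow_mult[symmetric] m_ac)
  hence "x \<otimes> y = (u \<otimes> v) \<otimes> \<pi> [^] (val x + val y)" using u(2) v(2) by simp
  thus ?thesis using val_eq[OF U_mult[OF u(1) v(1)]] by simp
qed

lemma quotient_in_U:
  assumes "x \<in> S'" "y \<in> S'" "val x = val y"
  shows "x \<otimes> inv y \<in> U"
proof -
  obtain u v where u: "u \<in> U" "x = u \<otimes> \<pi> [^] val x" and v: "v \<in> U" "y = v \<otimes> \<pi> [^] val y"
    using factorE assms by metis
  note c = S'_carrier[OF U_S'[OF u(1)]] S'_carrier[OF U_S'[OF v(1)]] S'_carrier[OF pi_pow[of "val y"]]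
  have "u \<otimes> \<pi> [^] val y = (u \<otimes> inv v) \<otimes> (v \<otimes> \<pi> [^] val y)"
    using c by (metis inv_nonzero(1) l_inv_nonzero l_one m_assoc m_closed)
  hence "x \<otimes> inv y = u \<otimes> inv v"
    using u v assms c by (metis S'_carrier inv_nonzero(1) m_closed mult_inv_eq_iff)
  thus ?thesis using U_mult[OF u(1) U_inv[OF v(1)]] by simp
qed

section \<open>The action of G on S and its units\<close>

lemma action_S':
  assumes "\<alpha> \<in> carrier G" "x \<in> S'"
  shows "\<alpha> x \<in> S'"
proof -
  interpret h: ring_hom_ring L L \<alpha>
    using action_hom[OF assms(1)] by (intro ring_hom_ringI2) (auto simp: ring_axioms)
  have "\<alpha> x \<otimes> \<alpha> (inv x) = \<one>"
    using S'_carrier[OF assms(2)] h.hom_mult[of x "inv x"] by simp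
  hence "\<alpha> x \<noteq> \<zero>" using S'_carrier[OF assms(2)] by auto
  thus ?thesis using action_closed assms by auto
qed

lemma action_mult:
  assumes "\<alpha> \<in> carrier G" "x \<in> S'" "y \<in> S'"
  shows "\<alpha> (x \<otimes> y) = \<alpha> x \<otimes> \<alpha> y"
  using action_hom[OF assms(1)] S'_carrier assms(2,3) ring_hom_mult by metis

lemma action_U:
  assumes "\<alpha> \<in> carrier G" "u \<in> U"
  shows "\<alpha> u \<in> U"
proof -
  note S = action_S'[OF assms(1) U_S'[OF assms(2)]] action_S'[OF assms(1) U_S'[OF U_inv[OF assms(2)]]]
  have "\<alpha> u \<otimes> \<alpha> (inv u) = \<alpha> \<one>"
    using action_mult[OF assms(1) U_S'[OF assms(2)] U_S'[OF U_inv[OF assms(2)]]]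
      S'_carrier[OF U_S'[OF assms(2)]] by simp
  also have "\<dots> = \<one>" using action_hom[OF assms(1)] ring_hom_one by metis
  finally have "inv (\<alpha> u) = \<alpha> (inv u)" using S[THEN S'_carrier(1)] comm_inv_char by metis
  thus ?thesis using S by (simp add: U_iff)
qed

text \<open>A factorization u \<pi>^n is mapped to (\<alpha> u) \<pi>^n, and \<alpha> u is again a
  unit.\<close>

lemma val_action:
  assumes "\<alpha> \<in> carrier G" "x \<in> S'"
  shows "val (\<alpha> x) = val x"
proof -
  interpret h: ring_hom_ring L L \<alpha>
    using action_hom[OF assms(1)] by (intro ring_hom_ringI2) (auto simp: ring_axioms)
  obtain u where u: "u \<in> U" "x = u \<otimes> \<pi> [^] val x" using factorE assms by metis
  have "\<alpha> (u \<otimes> \<pi> [^] val x) = \<alpha> u \<otimes> \<pi> [^] val x"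
    using action_mult[OF assms(1) U_S'[OF u(1)] pi_pow] action_pi[OF assms(1)]
      h.hom_nat_pow S_carrier[OF pi(1)] by simp
  hence "\<alpha> x = \<alpha> u \<otimes> \<pi> [^] val x" using u(2) by simp
  thus ?thesis using val_eq[OF action_U[OF assms(1) u(1)]] by simp
qed

section \<open>Normalized cochains and their coboundaries\<close>

definition cochains :: "'a set \<Rightarrow> (('a \<Rightarrow> 'a) \<Rightarrow> 'a) set" where
  "cochains M = {a \<in> carrier G \<rightarrow>\<^sub>E M. a \<one>\<^bsub>G\<^esub> = \<one>}"

text \<open>The restriction to pairs from G makes this an extensional function, so that elements of
  \<open>B2\<close> are literally equal to coboundaries.\<close>

definition coboundary :: "(('a \<Rightarrow> 'a) \<Rightarrow> 'a) \<Rightarrow> ('a \<Rightarrow> 'a) \<times> ('a \<Rightarrow> 'a) \<Rightarrow> 'a" where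
  "coboundary a = (\<lambda>(\<alpha>, \<beta>) \<in> carrier G \<times> carrier G. a \<alpha> \<otimes> \<alpha> (a \<beta>) \<otimes> inv (a (\<alpha> \<otimes>\<^bsub>G\<^esub> \<beta>)))"

lemma coboundary_apply:
  "\<alpha> \<in> carrier G \<Longrightarrow> \<beta> \<in> carrier G \<Longrightarrow>
    coboundary a (\<alpha>, \<beta>) = a \<alpha> \<otimes> \<alpha> (a \<beta>) \<otimes> inv (a (\<alpha> \<otimes>\<^bsub>G\<^esub> \<beta>))"
  by (simp add: coboundary_def)

lemma cochains_mem: "a \<in> cochains M \<Longrightarrow> \<alpha> \<in> carrier G \<Longrightarrow> a \<alpha> \<in> M"
  by (auto simp: cochains_def)

lemma cochains_mono: "M \<subseteq> N \<Longrightarrow> cochains M \<subseteq> cochains N"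
  by (auto simp: cochains_def)

text \<open>This moves all later arguments to cochains. The condition on the values has force for
  \<open>S'\<close>, where the inverse may lead out of S; \<open>H_iff\<close> removes it for
  units.\<close>

lemma carrier_B2: "carrier (B2 L G M) = {coboundary a | a. a \<in> cochains M \<and>
    (\<forall>\<alpha> \<in> carrier G. \<forall>\<beta> \<in> carrier G. coboundary a (\<alpha>, \<beta>) \<in> M)}"
proof (intro equalityI subsetI)
  fix b assume "b \<in> carrier (B2 L G M)"
  then obtain a where b: "b \<in> carrier G \<times> carrier G \<rightarrow>\<^sub>E M" and a: "a \<in> cochains M"
    "\<forall>\<alpha> \<in> carrier G. \<forall>\<beta> \<in> carrier G. b (\<alpha>, \<beta>) = a \<alpha> \<otimes> \<alpha> (a \<beta>) \<otimes> inv (a (\<alpha> \<otimes>\<^bsub>G\<^esub> \<beta>))"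
    by (auto simp: B2_def cochains_def)
  have "b = coboundary a"
    using a(2) b by (intro extensionalityI[of _ "carrier G \<times> carrier G"])
      (auto simp: coboundary_def PiE_def)
  thus "b \<in> {coboundary a | a. a \<in> cochains M \<and>
    (\<forall>\<alpha> \<in> carrier G. \<forall>\<beta> \<in> carrier G. coboundary a (\<alpha>, \<beta>) \<in> M)}" using a(1) b by auto
next
  fix b assume "b \<in> {coboundary a | a. a \<in> cochains M \<and>
    (\<forall>\<alpha> \<in> carrier G. \<forall>\<beta> \<in> carrier G. coboundary a (\<alpha>, \<beta>) \<in> M)}"
  then obtain a where a: "b = coboundary a" "a \<in> cochains M"
    "\<forall>\<alpha> \<in> carrier G. \<forall>\<beta> \<in> carrier G. coboundary a (\<alpha>, \<beta>) \<in> M" by blast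
  have "b \<in> carrier G \<times> carrier G \<rightarrow>\<^sub>E M"
    using a by (auto simp: PiE_def coboundary_def)
  thus "b \<in> carrier (B2 L G M)"
    using a coboundary_apply[of _ _ a] by (auto simp: B2_def cochains_def)
qed

abbreviation "B \<equiv> B2 L G S'"
abbreviation "H \<equiv> carrier (B2 L G U)"

definition cochain_mult :: "(('a \<Rightarrow> 'a) \<Rightarrow> 'a) \<Rightarrow> (('a \<Rightarrow> 'a) \<Rightarrow> 'a) \<Rightarrow> ('a \<Rightarrow> 'a) \<Rightarrow> 'a" where
  "cochain_mult a c = (\<lambda>\<alpha> \<in> carrier G. a \<alpha> \<otimes> c \<alpha>)"

lemma cochain_mult_S': "a \<in> cochains S' \<Longrightarrow> c \<in> cochains S' \<Longrightarrow> cochain_mult a c \<in> cochains S'"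
  using S'_mult[OF cochains_mem cochains_mem, of a _ c]
  by (auto simp: cochain_mult_def cochains_def PiE_iff)

lemma cochain_mult_U: "a \<in> cochains U \<Longrightarrow> c \<in> cochains U \<Longrightarrow> cochain_mult a c \<in> cochains U"
  using U_mult[OF cochains_mem cochains_mem, of a _ c]
  by (auto simp: cochain_mult_def cochains_def PiE_iff)

lemma B_mult: "x \<otimes>\<^bsub>B2 L G M\<^esub> y = (\<lambda>p \<in> carrier G \<times> carrier G. x p \<otimes> y p)"
  by (simp add: B2_def)

text \<open>Holds because \<alpha> is multiplicative and L commutative. The set M stays free since
  the product of \<open>B2\<close> does not depend on it; the rule serves both \<open>B\<close> and
  \<open>H\<close>.\<close>

lemma coboundary_mult:
  assumes a: "a \<in> cochains S'" and c: "c \<in> cochains S'"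
  shows "coboundary (cochain_mult a c) = coboundary a \<otimes>\<^bsub>B2 L G M\<^esub> coboundary c"
proof (rule extensionalityI[of _ "carrier G \<times> carrier G"])
  fix p assume "p \<in> carrier G \<times> carrier G"
  then obtain \<alpha> \<beta> where p: "p = (\<alpha>, \<beta>)" and st: "\<alpha> \<in> carrier G" "\<beta> \<in> carrier G" by auto
  have stm: "\<alpha> \<otimes>\<^bsub>G\<^esub> \<beta> \<in> carrier G" using st by simp
  note m = cochains_mem[OF a st(1)] cochains_mem[OF c st(1)] cochains_mem[OF a stm] cochains_mem[OF c stm]
    action_S'[OF st(1) cochains_mem[OF a st(2)]] action_S'[OF st(1) cochains_mem[OF c st(2)]]
  note cc = m[THEN S'_carrier(1)] m[THEN S'_carrier(2)]
  have "coboundary (cochain_mult a c) p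
    = (a \<alpha> \<otimes> c \<alpha>) \<otimes> (\<alpha> (a \<beta>) \<otimes> \<alpha> (c \<beta>)) \<otimes> (inv (a (\<alpha> \<otimes>\<^bsub>G\<^esub> \<beta>)) \<otimes> inv (c (\<alpha> \<otimes>\<^bsub>G\<^esub> \<beta>)))"
    using p st stm cc action_mult[OF st(1) cochains_mem[OF a st(2)] cochains_mem[OF c st(2)]]
    by (simp add: coboundary_apply cochain_mult_def)
  also have "\<dots> = coboundary a p \<otimes> coboundary c p"
    using p st cc by (simp add: coboundary_apply m_ac)
  finally show "coboundary (cochain_mult a c) p = (coboundary a \<otimes>\<^bsub>B2 L G M\<^esub> coboundary c) p"
    using p st by (simp add: B_mult)
qed (auto simp: coboundary_def B_mult)

text \<open>The action of \<alpha> disappears by \<open>val_action\<close>. The denominators are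
  moved across because the valuations are natural numbers.\<close>

lemma val_coboundary:
  assumes a: "a \<in> cochains S'" and c: "c \<in> cochains S'"
    and st: "\<alpha> \<in> carrier G" "\<beta> \<in> carrier G"
    and eq: "a \<alpha> \<otimes> \<alpha> (a \<beta>) \<otimes> inv (a (\<alpha> \<otimes>\<^bsub>G\<^esub> \<beta>)) = c \<alpha> \<otimes> \<alpha> (c \<beta>) \<otimes> inv (c (\<alpha> \<otimes>\<^bsub>G\<^esub> \<beta>))"
  shows "val (a \<alpha>) + val (a \<beta>) + val (c (\<alpha> \<otimes>\<^bsub>G\<^esub> \<beta>)) = val (c \<alpha>) + val (c \<beta>) + val (a (\<alpha> \<otimes>\<^bsub>G\<^esub> \<beta>))"
proof -
  have stm: "\<alpha> \<otimes>\<^bsub>G\<^esub> \<beta> \<in> carrier G" using st by simp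
  note m = cochains_mem[OF a st(1)] cochains_mem[OF c st(1)] cochains_mem[OF a stm] cochains_mem[OF c stm]
    action_S'[OF st(1) cochains_mem[OF a st(2)]] action_S'[OF st(1) cochains_mem[OF c st(2)]]
  let ?x = "a \<alpha> \<otimes> \<alpha> (a \<beta>)" and ?y = "c \<alpha> \<otimes> \<alpha> (c \<beta>)" and ?i = "a (\<alpha> \<otimes>\<^bsub>G\<^esub> \<beta>)" and ?j = "c (\<alpha> \<otimes>\<^bsub>G\<^esub> \<beta>)"
  have "?x \<otimes> ?j = ?y \<otimes> ?i"
    using S'_mult[OF m(1,5)] S'_mult[OF m(2,6)] m(3,4) eq by (rule cross_multiply)
  hence "val (?x \<otimes> ?j) = val (?y \<otimes> ?i)" by simp
  thus ?thesis
    using val_action[OF st(1) cochains_mem[OF a st(2)]] val_action[OF st(1) cochains_mem[OF c st(2)]]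
    unfolding val_mult[OF S'_mult[OF m(1,5)] m(4)] val_mult[OF S'_mult[OF m(2,6)] m(3)]
      val_mult[OF m(1,5)] val_mult[OF m(2,6)] by simp
qed

text \<open>For cochains with the same coboundary the difference of the valuations is a homomorphism
  from a finite monoid to the integers, hence zero.\<close>

lemma val_cochain_unique:
  assumes a: "a \<in> cochains S'" and c: "c \<in> cochains S'" and eq: "coboundary a = coboundary c"
    and s: "\<alpha> \<in> carrier G"
  shows "val (a \<alpha>) = val (c \<alpha>)"
proof -
  define f where "f = (\<lambda>\<alpha>. int (val (a \<alpha>)) - int (val (c \<alpha>)))"
  have add: "f (\<alpha> \<otimes>\<^bsub>G\<^esub> \<beta>) = f \<alpha> + f \<beta>" if st: "\<alpha> \<in> carrier G" "\<beta> \<in> carrier G" for \<alpha> \<beta>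
    using val_coboundary[OF a c st] coboundary_apply[OF st, of a] coboundary_apply[OF st, of c] eq
    by (simp add: f_def)
  have one: "f \<one>\<^bsub>G\<^esub> = 0" using a c by (simp add: f_def cochains_def)
  have pow: "f (\<alpha> [^]\<^bsub>G\<^esub> n) = int n * f \<alpha>" for n :: nat
    by (induct n) (use s in \<open>auto simp: one add algebra_simps\<close>)
  \<comment> \<open>The powers of \<alpha> form a finite set, whereas n \<mapsto> n * f \<alpha>
    would be injective on the naturals if f \<alpha> were nonzero.\<close>
  have "range (\<lambda>n :: nat. int n * f \<alpha>) \<subseteq> f ` carrier G"
    unfolding pow[symmetric] using s by blast
  hence "finite (range (\<lambda>n :: nat. int n * f \<alpha>))"
    using G(2) by (meson finite_imageI finite_subset)
  hence "\<not> inj (\<lambda>n :: nat. int n * f \<alpha>)" using finite_imageD by blast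
  hence "f \<alpha> = 0" by (auto simp: inj_def)
  thus ?thesis by (simp add: f_def)
qed

section \<open>The map from coboundaries to Sl(G)\<close>

definition exponent :: "(('a \<Rightarrow> 'a) \<times> ('a \<Rightarrow> 'a) \<Rightarrow> 'a) \<Rightarrow> ('a \<Rightarrow> 'a) \<Rightarrow> nat" where
  "exponent b = (\<lambda>\<alpha> \<in> carrier G. val ((SOME a. a \<in> cochains S' \<and> coboundary a = b) \<alpha>))"

text \<open>\<open>exponent\<close> has to choose a cochain by \<open>SOME\<close>; by
  \<open>val_cochain_unique\<close> the valuations do not depend on the choice, and from here on the
  choice is invisible.\<close>

lemma exponent_coboundary:
  assumes "a \<in> cochains S'"
  shows "exponent (coboundary a) = (\<lambda>\<alpha> \<in> carrier G. val (a \<alpha>))"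
proof -
  have "\<exists>c. c \<in> cochains S' \<and> coboundary c = coboundary a" using assms by blast
  from someI_ex[OF this] show ?thesis
    using val_cochain_unique[OF _ assms] unfolding exponent_def by (intro restrict_ext) auto
qed

lemma B_E:
  assumes "x \<in> carrier B"
  obtains a where "a \<in> cochains S'" "x = coboundary a"
    "\<forall>\<alpha> \<in> carrier G. \<forall>\<beta> \<in> carrier G. coboundary a (\<alpha>, \<beta>) \<in> S'"
  using assms unfolding carrier_B2 by blast

text \<open>Units are closed under products, inverses and the action, so every cochain of units has
  a coboundary with unit values.\<close>

lemma H_iff: "h \<in> H \<longleftrightarrow> (\<exists>a \<in> cochains U. h = coboundary a)"
proof
  assume "\<exists>a \<in> cochains U. h = coboundary a"
  then obtain a where a: "a \<in> cochains U" "h = coboundary a" by blast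
  have "coboundary a (\<alpha>, \<beta>) \<in> U" if "\<alpha> \<in> carrier G" "\<beta> \<in> carrier G" for \<alpha> \<beta>
    using cochains_mem[OF a(1)] that
    by (simp add: coboundary_apply U_mult U_inv action_U)
  thus "h \<in> H" using a unfolding carrier_B2 by blast
qed (auto simp: carrier_B2)

lemma cochains_U_S': "a \<in> cochains U \<Longrightarrow> a \<in> cochains S'"
  using cochains_mono[of U S'] U_S' by blast

lemma B_mult_closed:
  assumes "x \<in> carrier B" "y \<in> carrier B"
  shows "x \<otimes>\<^bsub>B\<^esub> y \<in> carrier B" and "exponent (x \<otimes>\<^bsub>B\<^esub> y) = exponent x \<otimes>\<^bsub>Sl G\<^esub> exponent y"
proof -
  obtain a where a: "a \<in> cochains S'" "x = coboundary a"
    "\<forall>\<alpha> \<in> carrier G. \<forall>\<beta> \<in> carrier G. coboundary a (\<alpha>, \<beta>) \<in> S'" by (rule B_E[OF assms(1)])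
  obtain c where c: "c \<in> cochains S'" "y = coboundary c"
    "\<forall>\<alpha> \<in> carrier G. \<forall>\<beta> \<in> carrier G. coboundary c (\<alpha>, \<beta>) \<in> S'" by (rule B_E[OF assms(2)])
  have eq: "x \<otimes>\<^bsub>B\<^esub> y = coboundary (cochain_mult a c)" using coboundary_mult[OF a(1) c(1)] a(2) c(2) by simp
  have "coboundary (cochain_mult a c) (\<alpha>, \<beta>) \<in> S'" if "\<alpha> \<in> carrier G" "\<beta> \<in> carrier G" for \<alpha> \<beta>
    unfolding coboundary_mult[OF a(1) c(1), of S'] using S'_mult[OF a(3)[rule_format, OF that] c(3)[rule_format, OF that]] that by (simp add: B_mult)
  thus "x \<otimes>\<^bsub>B\<^esub> y \<in> carrier B"
    using cochain_mult_S'[OF a(1) c(1)] eq unfolding carrier_B2 by blast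
  show "exponent (x \<otimes>\<^bsub>B\<^esub> y) = exponent x \<otimes>\<^bsub>Sl G\<^esub> exponent y"
    unfolding eq exponent_coboundary[OF cochain_mult_S'[OF a(1) c(1)]]
    unfolding a(2) c(2) exponent_coboundary[OF a(1)] exponent_coboundary[OF c(1)]
    using val_mult[OF cochains_mem[OF a(1)] cochains_mem[OF c(1)]]
    by (auto simp: Sl_def cochain_mult_def fun_eq_iff restrict_def)
qed

lemma one_cochain: "(\<lambda>\<alpha> \<in> carrier G. \<one>) \<in> cochains U"
  using one_U by (auto simp: cochains_def)

lemma one_coboundary: "\<one>\<^bsub>B2 L G M\<^esub> = coboundary (\<lambda>\<alpha> \<in> carrier G. \<one>)"
proof (rule extensionalityI[of _ "carrier G \<times> carrier G"])
  fix p assume "p \<in> carrier G \<times> carrier G"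
  thus "\<one>\<^bsub>B2 L G M\<^esub> p = coboundary (\<lambda>\<alpha> \<in> carrier G. \<one>) p"
    by (auto simp: B2_def coboundary_apply ring_hom_one[OF action_hom])
qed (auto simp: B2_def coboundary_def)

lemma one_H: "\<one>\<^bsub>B2 L G M\<^esub> \<in> H"
  unfolding H_iff one_coboundary using one_cochain by blast

lemma H_B: "H \<subseteq> carrier B"
  using U_S' cochains_U_S' unfolding carrier_B2 by blast

lemma exponent_one: "exponent \<one>\<^bsub>B\<^esub> = \<one>\<^bsub>Sl G\<^esub>"
  unfolding one_coboundary exponent_coboundary[OF cochains_U_S'[OF one_cochain]]
  using val_unit[OF one_U] by (auto simp: Sl_def fun_eq_iff restrict_def)

lemma exponent_image: "exponent ` carrier B = carrier (Sl G)"
proof (intro equalityI subsetI)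
  fix r assume "r \<in> exponent ` carrier B"
  then obtain x where x: "x \<in> carrier B" "r = exponent x" by blast
  obtain a where a: "a \<in> cochains S'" "x = coboundary a"
    "\<forall>\<alpha> \<in> carrier G. \<forall>\<beta> \<in> carrier G. coboundary a (\<alpha>, \<beta>) \<in> S'" by (rule B_E[OF x(1)])
  have r: "r = (\<lambda>\<alpha> \<in> carrier G. val (a \<alpha>))" using exponent_coboundary[OF a(1)] a(2) x(2) by simp
  have "val (a (\<alpha> \<otimes>\<^bsub>G\<^esub> \<beta>)) \<le> val (a \<alpha>) + val (a \<beta>)"
    if st: "\<alpha> \<in> carrier G" "\<beta> \<in> carrier G" for \<alpha> \<beta>
  proof -
    have stm: "\<alpha> \<otimes>\<^bsub>G\<^esub> \<beta> \<in> carrier G" using st by simp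
    note m = cochains_mem[OF a(1) st(1)] cochains_mem[OF a(1) stm]
      action_S'[OF st(1) cochains_mem[OF a(1) st(2)]] a(3)[rule_format, OF st]
    note cc = m[THEN S'_carrier(1)] m[THEN S'_carrier(2)]
    \<comment> \<open>All factors now lie in \<open>S'\<close>; the natural number that
      \<open>val\<close> assigns to the coboundary is the gap in the inequality.\<close>
    have "a \<alpha> \<otimes> \<alpha> (a \<beta>) = coboundary a (\<alpha>, \<beta>) \<otimes> a (\<alpha> \<otimes>\<^bsub>G\<^esub> \<beta>)"
      using coboundary_apply[OF st, of a] mult_inv_eq_iff cc by (metis m_closed)
    hence "val (a \<alpha> \<otimes> \<alpha> (a \<beta>)) = val (coboundary a (\<alpha>, \<beta>) \<otimes> a (\<alpha> \<otimes>\<^bsub>G\<^esub> \<beta>))" by simp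
    thus ?thesis using m val_mult val_action[OF st(1) cochains_mem[OF a(1) st(2)]] by simp
  qed
  moreover have "val (a \<one>\<^bsub>G\<^esub>) = 0" using a(1) val_unit[OF one_U] by (simp add: cochains_def)
  ultimately show "r \<in> carrier (Sl G)" by (auto simp: Sl_def r)
next
  fix r assume "r \<in> carrier (Sl G)"
  hence r: "r \<in> extensional (carrier G)" "r \<one>\<^bsub>G\<^esub> = 0"
    "\<And>\<alpha> \<beta>. \<alpha> \<in> carrier G \<Longrightarrow> \<beta> \<in> carrier G \<Longrightarrow> r (\<alpha> \<otimes>\<^bsub>G\<^esub> \<beta>) \<le> r \<alpha> + r \<beta>"
    by (auto simp: Sl_def PiE_def)
  let ?a = "\<lambda>\<alpha> \<in> carrier G. \<pi> [^] r \<alpha>"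
  have a: "?a \<in> cochains S'" using pi_pow r(2) by (auto simp: cochains_def)
  have "coboundary ?a (\<alpha>, \<beta>) \<in> S'" if st: "\<alpha> \<in> carrier G" "\<beta> \<in> carrier G" for \<alpha> \<beta>
  proof -
    interpret h: ring_hom_ring L L \<alpha>
      using action_hom[OF st(1)] by (intro ring_hom_ringI2) (auto simp: ring_axioms)
    have pic: "\<pi> \<in> carrier L" using S_carrier pi(1) by simp
    \<comment> \<open>Subadditivity makes the truncated subtraction exact, so the coboundary is a
      power of \<pi> with natural exponent.\<close>
    have "\<pi> [^] r \<alpha> \<otimes> \<pi> [^] r \<beta> = \<pi> [^] (r \<alpha> + r \<beta> - r (\<alpha> \<otimes>\<^bsub>G\<^esub> \<beta>)) \<otimes> \<pi> [^] r (\<alpha> \<otimes>\<^bsub>G\<^esub> \<beta>)"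
      using r(3)[OF st] pic by (simp add: nat_pow_mult)
    hence "coboundary ?a (\<alpha>, \<beta>) = \<pi> [^] (r \<alpha> + r \<beta> - r (\<alpha> \<otimes>\<^bsub>G\<^esub> \<beta>))"
      using st action_pi[OF st(1)] h.hom_nat_pow[OF pic] pic S'_carrier[OF pi_pow]
      by (simp add: coboundary_apply mult_inv_eq_iff)
    thus ?thesis using pi_pow by simp
  qed
  hence "coboundary ?a \<in> carrier B" using a unfolding carrier_B2 by blast
  moreover have "exponent (coboundary ?a) = r"
    unfolding exponent_coboundary[OF a] using r(1)
    by (intro extensionalityI[of _ "carrier G"]) (auto simp: val_pi_pow)
  ultimately show "r \<in> exponent ` carrier B" by (metis imageI)
qed

section \<open>Cosets of the unit coboundaries\<close>

lemma H_mult: "h \<in> H \<Longrightarrow> k \<in> H \<Longrightarrow> h \<otimes>\<^bsub>B2 L G M\<^esub> k \<in> H"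
  unfolding H_iff using coboundary_mult cochains_U_S' cochain_mult_U by metis

lemma B_value:
  assumes "x \<in> carrier B" "p \<in> carrier G \<times> carrier G"
  shows "x p \<in> carrier L"
proof -
  have "x \<in> carrier G \<times> carrier G \<rightarrow>\<^sub>E S'" using assms(1) by (simp add: B2_def)
  thus ?thesis using PiE_mem assms(2) S'_carrier(1) by metis
qed

lemma B_mult_assoc:
  assumes "x \<in> carrier B" "y \<in> carrier B" "z \<in> carrier B"
  shows "(x \<otimes>\<^bsub>B\<^esub> y) \<otimes>\<^bsub>B\<^esub> z = x \<otimes>\<^bsub>B\<^esub> (y \<otimes>\<^bsub>B\<^esub> z)"
proof -
  have "x p \<otimes> y p \<otimes> z p = x p \<otimes> (y p \<otimes> z p)" if "p \<in> carrier G \<times> carrier G" for p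
    using assms[THEN B_value, OF that] by (rule m_assoc)
  thus ?thesis unfolding B_mult by (intro restrict_ext) simp
qed

text \<open>Division by y may not be possible in \<open>B\<close>, but a / c is a cochain of units
  when the valuations agree. Its coboundary lies in \<open>H\<close> and carries y to x, so x h is y
  times an element of \<open>H\<close>.\<close>

lemma coset_subset:
  assumes x: "x \<in> carrier B" and y: "y \<in> carrier B" and eq: "exponent x = exponent y"
  shows "x <#\<^bsub>B\<^esub> H \<subseteq> y <#\<^bsub>B\<^esub> H"
proof -
  obtain a where a: "a \<in> cochains S'" "x = coboundary a" by (rule B_E[OF x])
  obtain c where c: "c \<in> cochains S'" "y = coboundary c" by (rule B_E[OF y])
  have v: "val (a \<alpha>) = val (c \<alpha>)" if "\<alpha> \<in> carrier G" for \<alpha>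
    using eq that unfolding a(2) c(2) exponent_coboundary[OF a(1)] exponent_coboundary[OF c(1)]
    by (metis restrict_apply')
  let ?u = "\<lambda>\<alpha> \<in> carrier G. a \<alpha> \<otimes> inv (c \<alpha>)"
  have u: "?u \<in> cochains U"
    using quotient_in_U[OF cochains_mem[OF a(1)] cochains_mem[OF c(1)] v] a(1) c(1)
    by (auto simp: cochains_def)
  have "c \<alpha> \<otimes> (a \<alpha> \<otimes> inv (c \<alpha>)) = a \<alpha>" if "\<alpha> \<in> carrier G" for \<alpha>
    using S'_carrier[OF cochains_mem[OF a(1) that]] S'_carrier[OF cochains_mem[OF c(1) that]]
    by (metis inv_nonzero(1) l_inv_nonzero m_assoc m_comm r_one)
  hence "a = cochain_mult c ?u"
    using a(1) by (intro extensionalityI[of _ "carrier G"]) (auto simp: cochain_mult_def cochains_def PiE_def)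
  hence xy: "x = y \<otimes>\<^bsub>B\<^esub> coboundary ?u"
    using coboundary_mult[OF c(1) cochains_U_S'[OF u]] a(2) c(2) by simp
  have uH: "coboundary ?u \<in> H" using u H_iff by blast
  show ?thesis
  proof
    fix z assume "z \<in> x <#\<^bsub>B\<^esub> H"
    then obtain h where h: "h \<in> H" "z = x \<otimes>\<^bsub>B\<^esub> h" by (auto simp: l_coset_def)
    hence "z = y \<otimes>\<^bsub>B\<^esub> (coboundary ?u \<otimes>\<^bsub>B\<^esub> h)"
      using xy B_mult_assoc[OF y, of "coboundary ?u" h] uH H_B by auto
    thus "z \<in> y <#\<^bsub>B\<^esub> H" using H_mult[OF uH h(1)] by (auto simp: l_coset_def)
  qed
qed

lemma coset_eq_iff:
  assumes x: "x \<in> carrier B" and y: "y \<in> carrier B"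
  shows "x <#\<^bsub>B\<^esub> H = y <#\<^bsub>B\<^esub> H \<longleftrightarrow> exponent x = exponent y"
proof
  assume eq: "x <#\<^bsub>B\<^esub> H = y <#\<^bsub>B\<^esub> H"
  obtain a where a: "a \<in> cochains S'" "x = coboundary a" by (rule B_E[OF x])
  obtain c where c: "c \<in> cochains S'" "y = coboundary c" by (rule B_E[OF y])
  \<comment> \<open>The product with the one of \<open>B\<close> agrees with x on pairs from G;
    extensionality extends this to equality, which places x in its own coset.\<close>
  have "x \<in> extensional (carrier G \<times> carrier G)" using x by (simp add: B2_def PiE_def)
  hence x1: "x = x \<otimes>\<^bsub>B\<^esub> \<one>\<^bsub>B\<^esub>"
    using B_value[OF x]
    by (intro extensionalityI[of _ "carrier G \<times> carrier G"]) (simp_all add: B2_def)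
  have "x \<otimes>\<^bsub>B\<^esub> \<one>\<^bsub>B\<^esub> \<in> y <#\<^bsub>B\<^esub> H"
    unfolding eq[symmetric] unfolding l_coset_def by (intro UN_I[OF one_H]) simp
  hence "x \<in> y <#\<^bsub>B\<^esub> H" using x1 by metis
  then obtain u where u: "u \<in> cochains U" "x = y \<otimes>\<^bsub>B\<^esub> coboundary u"
    by (auto simp: l_coset_def H_iff)
  have xu: "x = coboundary (cochain_mult c u)"
    using u coboundary_mult[OF c(1) cochains_U_S'[OF u(1)]] c(2) by simp
  show "exponent x = exponent y"
    unfolding xu exponent_coboundary[OF cochain_mult_S'[OF c(1) cochains_U_S'[OF u(1)]]]
    unfolding c(2) exponent_coboundary[OF c(1)]
    using val_mult[OF cochains_mem[OF c(1)] cochains_mem[OF cochains_U_S'[OF u(1)]]]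
      val_unit[OF cochains_mem[OF u(1)]]
    by (intro restrict_ext) (auto simp: cochain_mult_def)
next
  assume "exponent x = exponent y"
  thus "x <#\<^bsub>B\<^esub> H = y <#\<^bsub>B\<^esub> H" using coset_subset x y by (intro equalityI) auto
qed

theorem coboundary_quotient_iso:
  "monoid (quotient_monoid B H) \<and>
    (\<exists>\<phi> \<in> iso (quotient_monoid B H) (Sl G). \<phi> \<one>\<^bsub>quotient_monoid B H\<^esub> = \<one>\<^bsub>Sl G\<^esub>)"
  using H_B one_H
  by (intro quotient_monoid_kernel_iso[where f = exponent] monoid_Sl G(1))
    (auto simp: B_mult_closed exponent_one exponent_image coset_eq_iff)

end

section \<open>The Galois group\<close>

text \<open>Associativity and the unit laws are those of \<open>compose\<close> on extensional
  functions; what remains is closure of the K-automorphisms under composition.\<close>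

lemma monoid_Gal:
  assumes "ring L" "K \<subseteq> carrier L"
  shows "monoid (Gal L K)"
proof -
  interpret ring L by (rule assms(1))
  interpret B: group "BijGroup (carrier L)" by (rule group_BijGroup)
  have mem: "h \<in> carrier (Gal L K) \<longleftrightarrow>
      h \<in> Bij (carrier L) \<and> h \<in> ring_hom L L \<and> (\<forall>x \<in> K. h x = x)" for h
    by (simp add: Gal_def)
  have mult: "g \<otimes>\<^bsub>Gal L K\<^esub> h = compose (carrier L) g h"
    if "g \<in> carrier (Gal L K)" "h \<in> carrier (Gal L K)" for g h
    using that by (simp add: Gal_def BijGroup_def)
  have funcset: "h \<in> carrier L \<rightarrow> carrier L" if "h \<in> carrier (Gal L K)" for h
    using that mem Bij_imp_funcset by blast
  have one: "\<one>\<^bsub>Gal L K\<^esub> = (\<lambda>x \<in> carrier L. x)" by (simp add: Gal_def BijGroup_def)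
  have closed: "g \<otimes>\<^bsub>Gal L K\<^esub> h \<in> carrier (Gal L K)"
    if g: "g \<in> carrier (Gal L K)" and h: "h \<in> carrier (Gal L K)" for g h
  proof -
    have "compose (carrier L) g h \<in> Bij (carrier L)" using g h mem compose_Bij by blast
    moreover have "compose (carrier L) g h \<in> ring_hom L L"
    proof (rule ring_hom_memI)
      note gr = g[unfolded mem, THEN conjunct2, THEN conjunct1]
        and hr = h[unfolded mem, THEN conjunct2, THEN conjunct1]
      fix x y assume xy: "x \<in> carrier L" "y \<in> carrier L"
      note c = ring_hom_closed[OF hr xy(1)] ring_hom_closed[OF hr xy(2)]
      show "compose (carrier L) g h x \<in> carrier L"
        using xy c ring_hom_closed[OF gr c(1)] by (simp add: compose_eq)
      show "compose (carrier L) g h (x \<otimes>\<^bsub>L\<^esub> y) = compose (carrier L) g h x \<otimes>\<^bsub>L\<^esub> compose (carrier L) g h y"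
        using xy c by (simp add: compose_eq ring_hom_mult[OF hr] ring_hom_mult[OF gr])
      show "compose (carrier L) g h (x \<oplus>\<^bsub>L\<^esub> y) = compose (carrier L) g h x \<oplus>\<^bsub>L\<^esub> compose (carrier L) g h y"
        using xy c by (simp add: compose_eq ring_hom_add[OF hr] ring_hom_add[OF gr])
    next
      show "compose (carrier L) g h \<one>\<^bsub>L\<^esub> = \<one>\<^bsub>L\<^esub>"
        using g h mem ring_hom_one[of g L L] ring_hom_one[of h L L] by (simp add: compose_eq)
    qed
    moreover have "compose (carrier L) g h x = x" if "x \<in> K" for x
    proof -
      have "h x = x" "g x = x" "x \<in> carrier L" using g h mem that assms(2) by auto
      thus ?thesis by (simp add: compose_eq)
    qed
    ultimately show ?thesis using mult[OF g h] mem by metis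
  qed
  have one_closed: "(\<lambda>x \<in> carrier L. x) \<in> carrier (Gal L K)"
    using id_Bij assms(2) by (auto simp: mem subset_iff intro!: ring_hom_memI)
  show ?thesis
  proof (rule monoidI)
    fix f g h assume f: "f \<in> carrier (Gal L K)" and g: "g \<in> carrier (Gal L K)" and h: "h \<in> carrier (Gal L K)"
    show "f \<otimes>\<^bsub>Gal L K\<^esub> g \<in> carrier (Gal L K)" using closed[OF f g] .
    show "f \<otimes>\<^bsub>Gal L K\<^esub> g \<otimes>\<^bsub>Gal L K\<^esub> h = f \<otimes>\<^bsub>Gal L K\<^esub> (g \<otimes>\<^bsub>Gal L K\<^esub> h)"
      using mult[OF closed[OF f g] h] mult[OF f g] mult[OF f closed[OF g h]] mult[OF g h]
        compose_assoc[OF funcset[OF h]] by metis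
  next
    show "\<one>\<^bsub>Gal L K\<^esub> \<in> carrier (Gal L K)" unfolding one by (rule one_closed)
  next
    fix g assume g: "g \<in> carrier (Gal L K)"
    have "g \<in> extensional (carrier L)" using g mem Bij_imp_extensional by blast
    thus "\<one>\<^bsub>Gal L K\<^esub> \<otimes>\<^bsub>Gal L K\<^esub> g = g" "g \<otimes>\<^bsub>Gal L K\<^esub> \<one>\<^bsub>Gal L K\<^esub> = g"
      unfolding one mult[OF one_closed g] mult[OF g one_closed]
      using Id_compose[OF funcset[OF g]] compose_Id[OF funcset[OF g]] by auto
  qed
qed

lemma finite_Gal:
  assumes "finite_galois_extension L K"
  shows "finite (carrier (Gal L K))"
proof -
  have L: "field L" and K: "subfield K L" and fin: "ring.finite_dimension L K (carrier L)"
    using assms by (auto simp: finite_galois_extension_def)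
  interpret field L by (rule L)
  have "carrier (Gal L K) \<subseteq>
      {h \<in> extensional (carrier L). h \<in> ring_hom L L \<and> (\<forall>x \<in> K. h x = x)}"
    using Bij_imp_extensional by (auto simp: Gal_def)
  thus ?thesis using finite_ring_homs_fixing_subfield[OF K fin] by (rule finite_subset)
qed

theorem theorem3p6:
  fixes L :: "('a, 'b) ring_scheme"
    and K R M S :: "'a set"
    and G :: "('a \<Rightarrow> 'a) monoid"
    and Q :: "((('a \<Rightarrow> 'a) \<times> ('a \<Rightarrow> 'a)) \<Rightarrow> 'a) set monoid"
  assumes "finite_galois_extension L K"
    and "subring R L"
    and "discrete_valuation_ring (L\<lparr>carrier := R\<rparr>)"
    and "maximalideal M (L\<lparr>carrier := R\<rparr>)"
    and "adic_complete (L\<lparr>carrier := R\<rparr>) M"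
    and "finite (carrier (L\<lparr>carrier := R\<rparr> Quot M))"
    and "K = quotient_field_in L R"
    and "S = integral_closure L R"
    and "unramified M (L\<lparr>carrier := S\<rparr>)"
    and "G = Gal L K"
    and "Q = quotient_monoid (B2 L G (S - {\<zero>\<^bsub>L\<^esub>})) (carrier (B2 L G (Units (L\<lparr>carrier := S\<rparr>))))"
  shows "monoid Q \<and> monoid (Sl G) \<and> (\<exists>\<phi> \<in> iso Q (Sl G). \<phi> \<one>\<^bsub>Q\<^esub> = \<one>\<^bsub>Sl G\<^esub>)"
proof -
  have L: "field L" and K: "subfield K L"
    using assms(1) by (auto simp: finite_galois_extension_def)
  interpret field L by (rule L)
  note RE = subringE[OF assms(2)]
  have K_carrier: "K \<subseteq> carrier L" using subfieldE(3)[OF K] .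
  have R_K: "r \<in> K" if r: "r \<in> R" for r
  proof -
    have "r = r \<otimes>\<^bsub>L\<^esub> inv\<^bsub>L\<^esub> \<one>\<^bsub>L\<^esub>" using r RE(1) by auto
    thus ?thesis unfolding assms(7) quotient_field_in_def using r RE(3) one_not_zero by blast
  qed
  have integral: "\<exists>p. p \<noteq> [] \<and> set p \<subseteq> R \<and> hd p = \<one>\<^bsub>L\<^esub> \<and> eval p x = \<zero>\<^bsub>L\<^esub>" if "x \<in> S" for x
    using that unfolding assms(8) integral_closure_def by blast
  have S_carrier: "S \<subseteq> carrier L" unfolding assms(8) integral_closure_def by blast
  have R_S: "R \<subseteq> S"
  proof
    fix r assume r: "r \<in> R"
    hence rc: "r \<in> carrier L" using RE(1) by blast
    have "eval [\<one>\<^bsub>L\<^esub>, \<ominus>\<^bsub>L\<^esub> r] r = \<zero>\<^bsub>L\<^esub>" using rc by (simp add: r_neg)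
    moreover have "set [\<one>\<^bsub>L\<^esub>, \<ominus>\<^bsub>L\<^esub> r] \<subseteq> R" using r RE by simp
    ultimately show "r \<in> S" unfolding assms(8) integral_closure_def
      using rc by (intro CollectI conjI exI[of _ "[\<one>\<^bsub>L\<^esub>, \<ominus>\<^bsub>L\<^esub> r]"]) auto
  qed
  let ?R = "L\<lparr>carrier := R\<rparr>" and ?S = "L\<lparr>carrier := S\<rparr>"
  have max: "maximalideal (Idl\<^bsub>?S\<^esub> M) ?S" using assms(9) by (simp add: unramified_def)
  \<comment> \<open>An ideal lives in a ring by definition of the locale, so there is no need to show that sums
    and products of integral elements are integral.\<close>
  have "ring ?S" using max unfolding maximalideal_def ideal_def by blast
  hence S: "subring S L" by (rule ring_incl_imp_subring[OF S_carrier])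
  interpret S: cring ?S using subcring_iff[OF S_carrier] subcringI'[OF S] by simp
  have R: "principal_domain ?R" "\<not> field ?R" "\<exists>!P. maximalideal P ?R"
    using assms(3) by (auto simp: discrete_valuation_ring_def)
  obtain \<pi> where pi: "\<pi> \<in> R" "\<pi> \<noteq> \<zero>\<^bsub>L\<^esub>" "M = PIdl\<^bsub>?R\<^esub> \<pi>" "\<pi> \<notin> Units ?R"
    and fac: "\<And>x. x \<in> R - {\<zero>\<^bsub>L\<^esub>} \<Longrightarrow> \<exists>u \<in> Units ?R. \<exists>n :: nat. x = u \<otimes>\<^bsub>L\<^esub> \<pi> [^]\<^bsub>L\<^esub> n"
    using principal_domain.local_uniformizer[OF R assms(4)] by (auto simp: nat_pow_consistent[symmetric])
  \<comment> \<open>Both ideals are generated by \<pi>, since M = \<pi> R and R lies in S. The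
    ramification hypothesis thus says that \<pi> S is maximal.\<close>
  have "Idl\<^bsub>?S\<^esub> M = PIdl\<^bsub>?S\<^esub> \<pi>"
  proof (intro equalityI)
    have piS: "\<pi> \<in> carrier ?S" using pi(1) R_S by auto
    have "M \<subseteq> PIdl\<^bsub>?S\<^esub> \<pi>" unfolding pi(3) cgenideal_def using R_S by auto
    thus "Idl\<^bsub>?S\<^esub> M \<subseteq> PIdl\<^bsub>?S\<^esub> \<pi>" using S.genideal_minimal[OF S.cgenideal_ideal[OF piS]] by simp
    have "\<pi> \<in> M" unfolding pi(3) cgenideal_def using RE(1,3) pi(1) by (auto intro!: exI[of _ "\<one>\<^bsub>L\<^esub>"])
    moreover have "M \<subseteq> carrier ?S"
      using R_S ideal.Icarr[OF maximalideal.axioms(1)[OF assms(4)]] by auto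
    ultimately have "\<pi> \<in> Idl\<^bsub>?S\<^esub> M" using S.genideal_self by blast
    thus "PIdl\<^bsub>?S\<^esub> \<pi> \<subseteq> Idl\<^bsub>?S\<^esub> M"
      using S.cgenideal_minimal[OF maximalideal.axioms(1)[OF max]] by blast
  qed
  hence maxS: "maximalideal {s \<otimes>\<^bsub>L\<^esub> \<pi> | s. s \<in> S} ?S" using max by (simp add: cgenideal_def)
  \<comment> \<open>Being a nonunit of R does not pass to S by itself; here it follows because the
    maximal ideal \<pi> S is proper.\<close>
  have "\<pi> \<notin> Units ?S"
  proof
    assume "\<pi> \<in> Units ?S"
    hence "PIdl\<^bsub>?S\<^esub> \<pi> = carrier ?S" using S.ideal_eq_carrier_iff[of \<pi>] S.Units_closed by blast
    thus False using maximalideal.I_notcarr[OF maxS] by (auto simp: cgenideal_def)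
  qed
  have G: "\<sigma>' \<in> ring_hom L L" "\<And>x. x \<in> K \<Longrightarrow> \<sigma>' x = x" if "\<sigma>' \<in> carrier G" for \<sigma>'
    using that unfolding assms(10) Gal_def by auto
  \<comment> \<open>The coefficients of an integral equation lie in R, hence in K, and are fixed by
    g; so g x is a root of the same monic polynomial.\<close>
  have stable: "g x \<in> S" if g: "g \<in> carrier G" and x: "x \<in> S" for g x
  proof -
    have endo: "ring_hom_ring L L g" using G(1)[OF g] ring_axioms by (intro ring_hom_ringI2)
    obtain p where p: "p \<noteq> []" "set p \<subseteq> R" "hd p = \<one>\<^bsub>L\<^esub>" "eval p x = \<zero>\<^bsub>L\<^esub>"
      using integral[OF x] by blast
    have xc: "x \<in> carrier L" using x S_carrier by blast
    have "map g p = p" using p(2) G(2)[OF g] R_K by (intro map_idI) auto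
    hence "eval p (g x) = g \<zero>\<^bsub>L\<^esub>"
      using ring_hom_ring.eval_hom'[OF endo xc, of p] p(2,4) RE(1) by auto
    hence "eval p (g x) = \<zero>\<^bsub>L\<^esub>" using ring_hom_zero[OF G(1)[OF g] ring_axioms ring_axioms] by simp
    thus ?thesis unfolding assms(8) integral_closure_def
      using p ring_hom_closed[OF G(1)[OF g] xc] by blast
  qed
  have monG: "monoid G" unfolding assms(10) by (rule monoid_Gal[OF ring_axioms K_carrier])
  have "galois_valuation L S \<pi> G"
  proof (intro galois_valuation.intro galois_valuation_axioms.intro)
    show "\<exists>u \<in> Units ?S. \<exists>n :: nat. x = u \<otimes>\<^bsub>L\<^esub> \<pi> [^]\<^bsub>L\<^esub> n" if "x \<in> S - {\<zero>\<^bsub>L\<^esub>}" for x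
      using integral_extension_uniformizer[OF assms(2) S R_S integral pi(1,2,4) fac maxS that] .
    show "finite (carrier G)" unfolding assms(10) by (rule finite_Gal[OF assms(1)])
  qed (use L S pi R_S \<open>\<pi> \<notin> Units ?S\<close> monG G stable R_K in auto)
  from galois_valuation.coboundary_quotient_iso[OF this] show ?thesis
    using monoid_Sl[OF monG] unfolding assms(11) by blast
qed

end
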